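(* The logic $\mathsf{S4I}$ has the finite frame property: for every formula $\varphi$ of $\mathcal L$, if $\varphi$ is falsifiable (respectively satisfiable) on some $\mathsf{S4I}$ frame, then $\varphi$ is falsifiable (respectively satisfiable) on some finite $\mathsf{S4I}$ frame. Hence $\mathsf{S4I}$ is decidable (membership of a given formula in $\mathsf{S4I}$ is decidable).
   Context: Fix a countably infinite set $\mathbb P$ of propositional variables. The language $\mathcal L$: $\varphi ::= p \mid \bot \mid (\varphi\wedge\varphi)\mid(\varphi\vee\varphi)\mid(\varphi\to\varphi)\mid\Diamond\varphi\mid\Box\varphi$, $p\in\mathbb P$; $\neg\varphi:=\varphi\to\bot$. A logic is a set of formulas closed under substitution. $\mathsf{CS4}$ is the smallest logic containing all intuitionistic propositional tautologies (in $\mathcal L$) and the axioms $\Box(p\to q)\to(\Box p\to\Box q)$, $\Box(p\to q)\to(\Diamond p\to\Diamond q)$, $\Box p\to p$, $p\to\Diamond p$, $\Diamond\Diamond p\to\Diamond p$, $\Box p\to\Box\Box p$, and closed under modus ponens and necessitation. $\mathsf{S4I}$ is the smallest such logic extending $\mathsf{CS4}$ that also contains $\Diamond(p\vee q)\to\Diamond p\vee\Diamond q$, $\neg\Diamond\bot$ and $\Box(p\vee q)\to\Box p\vee\Diamond q$. A bi-intuitionistic frame $(W,W^\bot,\preccurlyeq,\sqsubseteq)$: $\preccurlyeq,\sqsubseteq$ preorders on $W$, $W^\bot\subseteq W$ closed upward under both; infallible if $W^\bot=\varnothing$. Forth--up confluent: $w\preccurlyeq w'$, $w\sqsubseteq v$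 imply some $v'$ with $v\preccurlyeq v'$, $w'\sqsubseteq v'$. Forth--down confluent: $w\preccurlyeq v\sqsubseteq v'$ implies some $w'$ with $w\sqsubseteq w'\preccurlyeq v'$. An $\mathsf{S4I}$ frame is an infallible bi-intuitionistic frame that is forth--up and forth--down confluent. Valuations $V:\mathbb P\to2^W$ have each $V(p)$ $\preccurlyeq$-upward closed and containing $W^\bot$. Satisfaction: $w\models p$ iff $w\in V(p)$; $w\models\bot$ iff $w\in W^\bot$; $\wedge,\vee$ pointwise; $w\models\varphi\to\psi$ iff for all $v\succcurlyeq w$, $v\models\varphi$ implies $v\models\psi$; $w\models\Diamond\varphi$ iff for all $u\succcurlyeq w$ there is $v\sqsupseteq u$ with $v\models\varphi$; $w\models\Box\varphi$ iff for all $u,v$ with $w\preccurlyeq u\sqsubseteq v$, $v\models\varphi$. Falsifiable / satisfiable on a frame: for some valuation, some world outside $W^\bot$ fails / satisfies $\varphi$. *)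

theory Defs
  imports Main "HOL-Library.Nat_Bijection"
begin

text \<open>The propositional variables are indexed by the natural numbers.\<close>

datatype fm =
    Var nat
  | Bot
  | And fm fm
  | Or fm fm
  | Imp fm fm
  | Dia fm
  | Box fm

abbreviation Neg :: "fm \<Rightarrow> fm" where
  "Neg a \<equiv> Imp a Bot"

primrec subst :: "(nat \<Rightarrow> fm) \<Rightarrow> fm \<Rightarrow> fm" where
  "subst s (Var n) = s n"
| "subst s Bot = Bot"
| "subst s (And a b) = And (subst s a) (subst s b)"
| "subst s (Or a b) = Or (subst s a) (subst s b)"
| "subst s (Imp a b) = Imp (subst s a) (subst s b)"
| "subst s (Dia a) = Dia (subst s a)"
| "subst s (Box a) = Box (subst s a)"

text \<open>Intuitionistic tautologies in the full language, that is, all substitution instances of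
  theorems of intuitionistic propositional logic: a Hilbert calculus whose schemes range over
  all formulas, so that formulas starting with a modality behave like variables.\<close>

inductive_set ipc_taut :: "fm set" where
  ax_K: "Imp a (Imp b a) \<in> ipc_taut"
| ax_S: "Imp (Imp a (Imp b c)) (Imp (Imp a b) (Imp a c)) \<in> ipc_taut"
| ax_conjE1: "Imp (And a b) a \<in> ipc_taut"
| ax_conjE2: "Imp (And a b) b \<in> ipc_taut"
| ax_conjI: "Imp a (Imp b (And a b)) \<in> ipc_taut"
| ax_disjI1: "Imp a (Or a b) \<in> ipc_taut"
| ax_disjI2: "Imp b (Or a b) \<in> ipc_taut"
| ax_disjE: "Imp (Imp a c) (Imp (Imp b c) (Imp (Or a b) c)) \<in> ipc_taut"
| ax_botE: "Imp Bot a \<in> ipc_taut"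
| mp: "\<lbrakk>Imp a b \<in> ipc_taut; a \<in> ipc_taut\<rbrakk> \<Longrightarrow> b \<in> ipc_taut"

abbreviation (input) "vp \<equiv> Var 0"
abbreviation (input) "vq \<equiv> Var 1"

inductive_set CS4 :: "fm set" where
  taut: "a \<in> ipc_taut \<Longrightarrow> a \<in> CS4"
| box_K: "Imp (Box (Imp vp vq)) (Imp (Box vp) (Box vq)) \<in> CS4"
| dia_K: "Imp (Box (Imp vp vq)) (Imp (Dia vp) (Dia vq)) \<in> CS4"
| box_T: "Imp (Box vp) vp \<in> CS4"
| dia_T: "Imp vp (Dia vp) \<in> CS4"
| dia_4: "Imp (Dia (Dia vp)) (Dia vp) \<in> CS4"
| box_4: "Imp (Box vp) (Box (Box vp)) \<in> CS4"
| subst: "a \<in> CS4 \<Longrightarrow> subst s a \<in> CS4"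
| mp: "\<lbrakk>Imp a b \<in> CS4; a \<in> CS4\<rbrakk> \<Longrightarrow> b \<in> CS4"
| nec: "a \<in> CS4 \<Longrightarrow> Box a \<in> CS4"

inductive_set S4I :: "fm set" where
  cs4: "a \<in> CS4 \<Longrightarrow> a \<in> S4I"
| dia_disj: "Imp (Dia (Or vp vq)) (Or (Dia vp) (Dia vq)) \<in> S4I"
| dia_bot: "Neg (Dia Bot) \<in> S4I"
| box_disj: "Imp (Box (Or vp vq)) (Or (Box vp) (Dia vq)) \<in> S4I"
| subst: "a \<in> S4I \<Longrightarrow> subst s a \<in> S4I"
| mp: "\<lbrakk>Imp a b \<in> S4I; a \<in> S4I\<rbrakk> \<Longrightarrow> b \<in> S4I"
| nec: "a \<in> S4I \<Longrightarrow> Box a \<in> S4I"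

record 'w frame =
  worlds :: "'w set"
  fallible :: "'w set"
  ile :: "('w \<times> 'w) set" \<comment> \<open>the intuitionistic preorder \<open>\<preccurlyeq>\<close>\<close>
  mle :: "('w \<times> 'w) set" \<comment> \<open>the modal preorder \<open>\<sqsubseteq>\<close>\<close>

definition up_closed :: "('w \<times> 'w) set \<Rightarrow> 'w set \<Rightarrow> bool" where
  "up_closed r A \<longleftrightarrow> (\<forall>w v. w \<in> A \<longrightarrow> (w, v) \<in> r \<longrightarrow> v \<in> A)"

definition bi_frame :: "'w frame \<Rightarrow> bool" where
  "bi_frame F \<longleftrightarrow>
     preorder_on (worlds F) (ile F) \<and> preorder_on (worlds F) (mle F) \<and>
     fallible F \<subseteq> worlds F \<and> up_closed (ile F) (fallible F) \<and> up_closed (mle F) (fallible F)"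

definition infallible :: "'w frame \<Rightarrow> bool" where
  "infallible F \<longleftrightarrow> fallible F = {}"

definition forth_up :: "'w frame \<Rightarrow> bool" where
  "forth_up F \<longleftrightarrow>
     (\<forall>w w' v. (w, w') \<in> ile F \<longrightarrow> (w, v) \<in> mle F \<longrightarrow> (\<exists>v'. (v, v') \<in> ile F \<and> (w', v') \<in> mle F))"

definition forth_down :: "'w frame \<Rightarrow> bool" where
  "forth_down F \<longleftrightarrow>
     (\<forall>w v v'. (w, v) \<in> ile F \<longrightarrow> (v, v') \<in> mle F \<longrightarrow> (\<exists>w'. (w, w') \<in> mle F \<and> (w', v') \<in> ile F))"

definition S4I_frame :: "'w frame \<Rightarrow> bool" where
  "S4I_frame F \<longleftrightarrow> bi_frame F \<and> infallible F \<and> forth_up F \<and> forth_down F"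

definition valuation :: "'w frame \<Rightarrow> (nat \<Rightarrow> 'w set) \<Rightarrow> bool" where
  "valuation F V \<longleftrightarrow>
     (\<forall>n. V n \<subseteq> worlds F \<and> up_closed (ile F) (V n) \<and> fallible F \<subseteq> V n)"

primrec sat :: "'w frame \<Rightarrow> (nat \<Rightarrow> 'w set) \<Rightarrow> 'w \<Rightarrow> fm \<Rightarrow> bool" where
  "sat F V w (Var n) \<longleftrightarrow> w \<in> V n"
| "sat F V w Bot \<longleftrightarrow> w \<in> fallible F"
| "sat F V w (And a b) \<longleftrightarrow> sat F V w a \<and> sat F V w b"
| "sat F V w (Or a b) \<longleftrightarrow> sat F V w a \<or> sat F V w b"
| "sat F V w (Imp a b) \<longleftrightarrow> (\<forall>v. (w, v) \<in> ile F \<longrightarrow> sat F V v a \<longrightarrow> sat F V v b)"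
| "sat F V w (Dia a) \<longleftrightarrow> (\<forall>u. (w, u) \<in> ile F \<longrightarrow> (\<exists>v. (u, v) \<in> mle F \<and> sat F V v a))"
| "sat F V w (Box a) \<longleftrightarrow> (\<forall>u v. (w, u) \<in> ile F \<longrightarrow> (u, v) \<in> mle F \<longrightarrow> sat F V v a)"

definition falsifiable_on :: "'w frame \<Rightarrow> fm \<Rightarrow> bool" where
  "falsifiable_on F a \<longleftrightarrow> (\<exists>V w. valuation F V \<and> w \<in> worlds F - fallible F \<and> \<not> sat F V w a)"

definition satisfiable_on :: "'w frame \<Rightarrow> fm \<Rightarrow> bool" where
  "satisfiable_on F a \<longleftrightarrow> (\<exists>V w. valuation F V \<and> w \<in> worlds F - fallible F \<and> sat F V w a)"

text \<open>Codes of partial recursive functions and the graphs of the functions they denote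
  (\<open>rec_eval f xs y\<close>: on arguments \<open>xs\<close> the function is defined with value \<open>y\<close>). Arities are
  not tracked: a code denotes one partial recursive function for each length of the argument
  list, undefined where the shape of the list does not fit.\<close>

datatype recf =
    Zero
  | Succ
  | Proj nat
  | Comp recf "recf list"
  | PrimRec recf recf
  | Mu recf

inductive rec_eval :: "recf \<Rightarrow> nat list \<Rightarrow> nat \<Rightarrow> bool" where
  zero: "rec_eval Zero xs 0"
| succ: "rec_eval Succ [x] (Suc x)"
| proj: "i < length xs \<Longrightarrow> rec_eval (Proj i) xs (xs ! i)"
| comp: "\<lbrakk>list_all2 (\<lambda>g y. rec_eval g xs y) gs ys; rec_eval f ys z\<rbrakk>
    \<Longrightarrow> rec_eval (Comp f gs) xs z"
| primrec_0: "rec_eval f xs y \<Longrightarrow> rec_eval (PrimRec f g) (0 # xs) y"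
| primrec_Suc: "\<lbrakk>rec_eval (PrimRec f g) (n # xs) y; rec_eval g (n # y # xs) z\<rbrakk>
    \<Longrightarrow> rec_eval (PrimRec f g) (Suc n # xs) z"
| mu: "\<lbrakk>rec_eval f (n # xs) 0; \<And>m. m < n \<Longrightarrow> \<exists>y. rec_eval f (m # xs) (Suc y)\<rbrakk>
    \<Longrightarrow> rec_eval (Mu f) xs n"

lemma rec_eval_functional: "rec_eval f xs y \<Longrightarrow> rec_eval f xs z \<Longrightarrow> y = z"
proof (induction f xs y arbitrary: z rule: rec_eval.induct)
  case (zero xs)
  from zero.prems show ?case by cases simp
next
  case (succ x)
  from succ.prems show ?case by cases simp
next
  case (proj i xs)
  from proj.prems show ?case by cases simp
next
  case (comp xs gs ys f z')
  from comp.prems obtain ys' where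
    ys': "list_all2 (\<lambda>g y. rec_eval g xs y) gs ys'" "rec_eval f ys' z"
    by cases blast
  have "ys = ys'"
  proof (rule nth_equalityI)
    show "length ys = length ys'"
      using comp.IH(1) ys'(1) by (simp add: list_all2_conv_all_nth)
    show "ys ! i = ys' ! i" if "i < length ys" for i
      using that comp.IH(1) ys'(1) by (simp add: list_all2_conv_all_nth)
  qed
  then show ?case using comp.IH(2) ys'(2) by blast
next
  case (primrec_0 f xs y g)
  from primrec_0.prems have "rec_eval f xs z" by cases simp_all
  then show ?case by (rule primrec_0.IH)
next
  case (primrec_Suc f g n xs y z')
  from primrec_Suc.prems obtain y' where
    y': "rec_eval (PrimRec f g) (n # xs) y'" "rec_eval g (n # y' # xs) z"
    by cases simp_all
  have "y = y'" using y'(1) by (rule primrec_Suc.IH(1))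
  with y'(2) show ?case using primrec_Suc.IH(2) by blast
next
  case (mu f n xs)
  from mu.prems have z: "rec_eval f (z # xs) 0" "\<And>m. m < z \<Longrightarrow> \<exists>y. rec_eval f (m # xs) (Suc y)"
    by (cases; simp)+
  have "\<not> n < z"
  proof
    assume "n < z"
    then obtain y where "rec_eval f (n # xs) (Suc y)" using z(2) by blast
    then have "0 = Suc y" by (rule mu.IH(1))
    then show False by simp
  qed
  moreover have "\<not> z < n"
  proof
    assume "z < n"
    then obtain y where y: "\<And>v. rec_eval f (z # xs) v \<Longrightarrow> Suc y = v" using mu.IH(2) by blast
    have "Suc y = 0" using z(1) by (rule y)
    then show False by simp
  qed
  ultimately show ?case by simp
qed

definition decidable_set :: "nat set \<Rightarrow> bool" where
  "decidable_set A \<longleftrightarrow> (\<exists>f. \<forall>n. rec_eval f [n] (if n \<in> A then 1 else 0))"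

text \<open>A bijective Goedel numbering: the residue modulo 6 of the predecessor gives the main
  connective.\<close>

primrec fm_code :: "fm \<Rightarrow> nat" where
  "fm_code Bot = 0"
| "fm_code (Var n) = Suc (6 * n)"
| "fm_code (And a b) = Suc (6 * prod_encode (fm_code a, fm_code b) + 1)"
| "fm_code (Or a b) = Suc (6 * prod_encode (fm_code a, fm_code b) + 2)"
| "fm_code (Imp a b) = Suc (6 * prod_encode (fm_code a, fm_code b) + 3)"
| "fm_code (Dia a) = Suc (6 * fm_code a + 4)"
| "fm_code (Box a) = Suc (6 * fm_code a + 5)"

lemma bij_fm_code: "bij fm_code"
proof (rule bijI)
  have rep: "i = j \<and> x = y" if eq: "6 * x + i = 6 * y + j" and ij: "i < 6" "j < 6" for x y i j :: nat
  proof -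
    have "i = j" using arg_cong[OF eq, of "\<lambda>k. k mod 6"] ij by simp
    then show ?thesis using eq by simp
  qed
  define args where "args a = (case a of Var n \<Rightarrow> (n, 0) | Bot \<Rightarrow> (0, 0)
    | And a b \<Rightarrow> (prod_encode (fm_code a, fm_code b), 1)
    | Or a b \<Rightarrow> (prod_encode (fm_code a, fm_code b), 2)
    | Imp a b \<Rightarrow> (prod_encode (fm_code a, fm_code b), 3)
    | Dia a \<Rightarrow> (fm_code a, 4) | Box a \<Rightarrow> (fm_code a, 5 :: nat))" for a
  have code: "fm_code a = Suc (6 * fst (args a) + snd (args a))" "snd (args a) < 6" if "a \<noteq> Bot" for a
    using that by (cases a, simp_all add: args_def) (cases a, simp_all add: args_def)
  have args_eq: "args a = args b" if "a \<noteq> Bot" "b \<noteq> Bot" "fm_code a = fm_code b" for a b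
  proof -
    have "6 * fst (args a) + snd (args a) = 6 * fst (args b) + snd (args b)"
      using code(1)[OF that(1)] code(1)[OF that(2)] that(3) by simp
    from rep[OF this code(2)[OF that(1)] code(2)[OF that(2)]]
    show ?thesis by (simp add: prod_eq_iff)
  qed
  have bot: "fm_code a = 0 \<longleftrightarrow> a = Bot" for a by (cases a) simp_all
  show "inj fm_code"
  proof (rule injI)
    show "fm_code a = fm_code b \<Longrightarrow> a = b" for a b
    proof (induction a arbitrary: b)
      case Bot
      then show ?case using bot[of b] by simp
    next
      case (Var n)
      then have "args (Var n) = args b" using bot[of b] by (intro args_eq) auto
      then show ?case using Var bot[of b] by (cases b) (simp_all add: args_def)
    next
      case (And a1 a2)
      then have "args (And a1 a2) = args b" using bot[of b] by (intro args_eq) auto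
      then show ?case using And bot[of b] by (cases b) (simp_all add: args_def)
    next
      case (Or a1 a2)
      then have "args (Or a1 a2) = args b" using bot[of b] by (intro args_eq) auto
      then show ?case using Or bot[of b] by (cases b) (simp_all add: args_def)
    next
      case (Imp a1 a2)
      then have "args (Imp a1 a2) = args b" using bot[of b] by (intro args_eq) auto
      then show ?case using Imp bot[of b] by (cases b) (simp_all add: args_def)
    next
      case (Dia a)
      then have "args (Dia a) = args b" using bot[of b] by (intro args_eq) auto
      then show ?case using Dia bot[of b] by (cases b) (simp_all add: args_def)
    next
      case (Box a)
      then have "args (Box a) = args b" using bot[of b] by (intro args_eq) auto
      then show ?case using Box bot[of b] by (cases b) (simp_all add: args_def)
    qed
  qed
  have "\<exists>a. fm_code a = n" for n
  proof (induction n rule: less_induct)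
    case (less n)
    show ?case
    proof (cases n)
      case 0
      then show ?thesis by (metis fm_code.simps(1))
    next
      case (Suc m)
      define k where "k = m div 6"
      obtain i j where ij: "k = prod_encode (i, j)"
        by (metis prod_decode_inverse surj_pair)
      have "i \<le> k" "j \<le> k"
        unfolding ij by (rule le_prod_encode_1, rule le_prod_encode_2)
      moreover have "k \<le> m" by (simp add: k_def)
      ultimately have lt: "i < n" "j < n" "k < n" using Suc by auto
      obtain a b c where abc: "fm_code a = i" "fm_code b = j" "fm_code c = k"
        using less.IH lt by meson
      have m: "m = 6 * k + m mod 6" by (simp add: k_def)
      have "m mod 6 < 6" by simp
      then have "m mod 6 \<in> {0, 1, 2, 3, 4, 5}"
        by (simp only: eval_nat_numeral less_Suc_eq) auto
      with m consider "m = 6 * k" | "m = 6 * k + 1" | "m = 6 * k + 2" | "m = 6 * k + 3"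
        | "m = 6 * k + 4" | "m = 6 * k + 5"
        by (metis add_0_right empty_iff insert_iff)
      then show ?thesis
      proof cases
        case 1
        then show ?thesis using Suc by (intro exI[of _ "Var k"]) simp
      next
        case 2
        then show ?thesis using Suc abc ij by (intro exI[of _ "And a b"]) simp
      next
        case 3
        then show ?thesis using Suc abc ij by (intro exI[of _ "Or a b"]) simp
      next
        case 4
        then show ?thesis using Suc abc ij by (intro exI[of _ "Imp a b"]) simp
      next
        case 5
        then show ?thesis using Suc abc by (intro exI[of _ "Dia c"]) simp
      next
        case 6
        then show ?thesis using Suc abc by (intro exI[of _ "Box c"]) simp
      qed
    qed
  qed
  then show "surj fm_code" unfolding surj_def by metis
qed

definition decidable_logic :: "fm set \<Rightarrow> bool" where
  "decidable_logic L \<longleftrightarrow> decidable_set (fm_code ` L)"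

end

theory Submission
  imports Defs "HOL-Library.FSet" "HOL-Library.Sublist"
begin

text \<open>
  Finite frames. Fix a model and a formula. The part of the model above a world can be approximated
  by a finite tree whose nodes carry sets of subformulas that strictly increase along edges, with a
  witness for every implication that fails; there are only finitely many such trees. The worlds of
  the finite frame are the paths in realised trees, ordered by extension. The modal relation
  is the existence of a monotone matching between paths along which the trees simulate each other:
  matchings restrict to initial segments and simulations extend them, which yields the
  two confluence conditions. The confluence of the given model, used from the head of a path down to
  its root, produces a matching path for every modal step.

  Decidability. The canonical model of prime theories is itself an \<open>S4I\<close> frame; hence derivability
  coincides with validity on finite frames. Derivations and finite countermodels (with their truth
  tables) are coded by numbers and recognised by recursive predicates, and a search for
  whichever of the two exists decides the logic.
\<close>

subsection \<open>Satisfaction on confluent frames\<close>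

text \<open>Quotienting the model by satisfaction of subformulas gives no control over the two
  confluence conditions. A path remembers the nodes it has passed, so downward confluence only has
  to shorten a matching. Upward confluence concerns the future of a node, which its label does not
  determine; this is why nodes are whole trees and are compared by simulation. Strict growth of
  labels inside a finite set bounds the depth of the trees. The price is that a modal step may
  stall: worlds of different type can have modal successors of equal type, and the path of
  successors may not repeat a label. Hence matchings need not be injective, and a tree that cannot
  become a kid is merged into the node before it (\<open>absorbs\<close>). The proof extracts no
  bound on the size of the finite frame. Decidability therefore does not come from checking all
  frames up to some size but from certificates for both answers, which is where completeness of the
  calculus enters.\<close>

locale S4I_model =
  fixes F :: "'w frame" and V :: "nat \<Rightarrow> 'w set"
  assumes frame: "S4I_frame F" and val: "valuation F V"
begin

lemma not_fallible [simp]: "fallible F = {}"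
  using frame by (simp add: S4I_frame_def infallible_def)

lemma ile_worlds: "(w, v) \<in> ile F \<Longrightarrow> w \<in> worlds F \<and> v \<in> worlds F"
  using frame by (auto simp: S4I_frame_def bi_frame_def preorder_on_def)

lemma mle_worlds: "(w, v) \<in> mle F \<Longrightarrow> w \<in> worlds F \<and> v \<in> worlds F"
  using frame by (auto simp: S4I_frame_def bi_frame_def preorder_on_def)

lemma ile_refl: "w \<in> worlds F \<Longrightarrow> (w, w) \<in> ile F"
  using frame by (auto simp: S4I_frame_def bi_frame_def preorder_on_def refl_on_def)

lemma mle_refl: "w \<in> worlds F \<Longrightarrow> (w, w) \<in> mle F"
  using frame by (auto simp: S4I_frame_def bi_frame_def preorder_on_def refl_on_def)

lemma ile_trans: "(u, v) \<in> ile F \<Longrightarrow> (v, w) \<in> ile F \<Longrightarrow> (u, w) \<in> ile F"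
  using frame unfolding S4I_frame_def bi_frame_def preorder_on_def by (meson transD)

lemma mle_trans: "(u, v) \<in> mle F \<Longrightarrow> (v, w) \<in> mle F \<Longrightarrow> (u, w) \<in> mle F"
  using frame unfolding S4I_frame_def bi_frame_def preorder_on_def by (meson transD)

lemma forth_upE:
  assumes "(w, w') \<in> ile F" "(w, v) \<in> mle F"
  obtains v' where "(v, v') \<in> ile F" "(w', v') \<in> mle F"
  using frame assms unfolding S4I_frame_def forth_up_def by blast

lemma forth_downE:
  assumes "(w, v) \<in> ile F" "(v, v') \<in> mle F"
  obtains w' where "(w, w') \<in> mle F" "(w', v') \<in> ile F"
  using frame assms unfolding S4I_frame_def forth_down_def by blast

lemma sat_mono: "(w, v) \<in> ile F \<Longrightarrow> sat F V w a \<Longrightarrow> sat F V v a"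
proof (induction a arbitrary: w v)
  case (Var n)
  then show ?case using val by (auto simp: valuation_def up_closed_def)
next
  case (Imp a b)
  then show ?case by (simp) (meson ile_trans)
next
  case (Dia a)
  then show ?case by (simp) (meson ile_trans)
next
  case (Box a)
  then show ?case by (simp) (meson ile_trans)
qed auto

text \<open>Upward confluence carries the modal witness along any intuitionistic step and
  persistence keeps \<open>a\<close> true there, so the outer quantifier of the clause collapses.
  \<open>sat_Box_iff\<close> is the dual, by downward confluence.\<close>

lemma sat_Dia_iff:
  assumes "w \<in> worlds F"
  shows "sat F V w (Dia a) \<longleftrightarrow> (\<exists>v. (w, v) \<in> mle F \<and> sat F V v a)"
proof
  show "sat F V w (Dia a) \<Longrightarrow> \<exists>v. (w, v) \<in> mle F \<and> sat F V v a"
    using assms ile_refl by auto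
  assume "\<exists>v. (w, v) \<in> mle F \<and> sat F V v a"
  then obtain v where v: "(w, v) \<in> mle F" "sat F V v a" by blast
  have "\<exists>v'. (u, v') \<in> mle F \<and> sat F V v' a" if u: "(w, u) \<in> ile F" for u
  proof -
    obtain v' where "(v, v') \<in> ile F" "(u, v') \<in> mle F" by (rule forth_upE[OF u v(1)])
    with sat_mono v(2) show ?thesis by blast
  qed
  then show "sat F V w (Dia a)" by simp
qed

lemma sat_Box_iff:
  assumes "w \<in> worlds F"
  shows "sat F V w (Box a) \<longleftrightarrow> (\<forall>v. (w, v) \<in> mle F \<longrightarrow> sat F V v a)"
proof
  show "sat F V w (Box a) \<Longrightarrow> \<forall>v. (w, v) \<in> mle F \<longrightarrow> sat F V v a"
    using assms ile_refl by auto
  assume *: "\<forall>v. (w, v) \<in> mle F \<longrightarrow> sat F V v a"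
  have "sat F V v a" if uv: "(w, u) \<in> ile F" "(u, v) \<in> mle F" for u v
  proof -
    obtain w' where "(w, w') \<in> mle F" "(w', v) \<in> ile F" by (rule forth_downE[OF uv])
    with * sat_mono show ?thesis by blast
  qed
  then show "sat F V w (Box a)" by simp
qed

lemma sat_Imp_mp:
  "sat F V w (Imp a b) \<Longrightarrow> sat F V w a \<Longrightarrow> w \<in> worlds F \<Longrightarrow> sat F V w b"
  using ile_refl by auto

end

subsection \<open>Transport of finite frames to the natural numbers\<close>

text \<open>Countermodel certificates address worlds by number, so finite frames are moved to
  initial segments of the naturals.\<close>

lemma transport_frame:
  fixes G :: "'a frame"
  assumes G: "S4I_frame G" "finite (worlds G)" "valuation G U" "w \<in> worlds G"
  obtains H :: "nat frame" and U' i where "S4I_frame H" "worlds H = {..<card (worlds G)}"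
    "valuation H U'" "i \<in> worlds H" "\<And>a. sat H U' i a \<longleftrightarrow> sat G U w a"
proof -
  interpret S4I_model G U by unfold_locales (fact G)+
  define n where "n = card (worlds G)"
  obtain g where "bij_betw g {..<n} (worlds G)"
    using G(2) n_def by (metis ex_bij_betw_nat_finite atLeast0LessThan)
  then have g: "inj_on g {..<n}" "g ` {..<n} = worlds G" by (auto simp: bij_betw_def)
  have gw: "g i \<in> worlds G" if "i < n" for i using g(2) that by auto
  have ex: "\<exists>i<n. v = g i" if "v \<in> worlds G" for v using g(2) that by auto
  define H :: "nat frame" where "H = \<lparr>worlds = {..<n}, fallible = {},
    ile = {(i, j). i < n \<and> j < n \<and> (g i, g j) \<in> ile G},
    mle = {(i, j). i < n \<and> j < n \<and> (g i, g j) \<in> mle G}\<rparr>"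
  define U' where "U' k = {i. i < n \<and> g i \<in> U k}" for k
  have U: "valuation H U'"
    using val by (auto simp: valuation_def up_closed_def H_def U'_def)
  have iH: "(i, j) \<in> ile H \<longleftrightarrow> i < n \<and> j < n \<and> (g i, g j) \<in> ile G"
    and mH: "(i, j) \<in> mle H \<longleftrightarrow> i < n \<and> j < n \<and> (g i, g j) \<in> mle G" for i j
    by (simp_all add: H_def)
  have fu: "forth_up H"
    unfolding forth_up_def iH mH
  proof (intro allI impI)
    fix i i' j
    assume *: "i < n \<and> i' < n \<and> (g i, g i') \<in> ile G" "i < n \<and> j < n \<and> (g i, g j) \<in> mle G"
    then obtain v' where v': "(g j, v') \<in> ile G" "(g i', v') \<in> mle G" using forth_upE by blast
    then obtain k where "k < n" "v' = g k" using ex ile_worlds by blast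
    with v' * show "\<exists>k. (j < n \<and> k < n \<and> (g j, g k) \<in> ile G) \<and>
        i' < n \<and> k < n \<and> (g i', g k) \<in> mle G" by blast
  qed
  have fd: "forth_down H"
    unfolding forth_down_def iH mH
  proof (intro allI impI)
    fix i i' j
    assume *: "i < n \<and> i' < n \<and> (g i, g i') \<in> ile G" "i' < n \<and> j < n \<and> (g i', g j) \<in> mle G"
    then obtain v' where v': "(g i, v') \<in> mle G" "(v', g j) \<in> ile G" using forth_downE by blast
    then obtain k where "k < n" "v' = g k" using ex ile_worlds by blast
    with v' * show "\<exists>k. (i < n \<and> k < n \<and> (g i, g k) \<in> mle G) \<and>
        k < n \<and> j < n \<and> (g k, g j) \<in> ile G" by blast
  qed
  have "preorder_on (worlds H) (ile H)"
    using ile_refl ile_trans gw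
    by (auto simp: preorder_on_def refl_on_def iH H_def intro!: transI)
  moreover have "preorder_on (worlds H) (mle H)"
    using mle_refl mle_trans gw
    by (auto simp: preorder_on_def refl_on_def mH H_def intro!: transI)
  ultimately have H: "S4I_frame H"
    using fu fd by (simp add: S4I_frame_def bi_frame_def infallible_def up_closed_def)
      (simp add: H_def)
  have il: "(\<forall>v. (g i, v) \<in> ile G \<longrightarrow> P v) \<longleftrightarrow> (\<forall>j<n. (g i, g j) \<in> ile G \<longrightarrow> P (g j))" for i P
    using ex ile_worlds by blast
  have ml: "(\<exists>v. (g i, v) \<in> mle G \<and> P v) \<longleftrightarrow> (\<exists>j<n. (g i, g j) \<in> mle G \<and> P (g j))" for i P
    using ex mle_worlds by blast
  have ml': "(\<forall>v. (g i, v) \<in> mle G \<longrightarrow> P v) \<longleftrightarrow> (\<forall>j<n. (g i, g j) \<in> mle G \<longrightarrow> P (g j))" for i P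
    using ml[of i "\<lambda>v. \<not> P v"] by blast
  have s: "sat H U' i a \<longleftrightarrow> sat G U (g i) a" if "i < n" for i a
    using that
  proof (induction a arbitrary: i)
    case (Imp a b)
    then show ?case by (auto simp: iH il)
  next
    case (Dia a)
    have "sat G U (g i) (Dia a) \<longleftrightarrow>
        (\<forall>j<n. (g i, g j) \<in> ile G \<longrightarrow> (\<exists>k<n. (g j, g k) \<in> mle G \<and> sat G U (g k) a))"
      by (simp add: il ml)
    also have "\<dots> \<longleftrightarrow> (\<forall>j<n. (g i, g j) \<in> ile G \<longrightarrow> (\<exists>k<n. (g j, g k) \<in> mle G \<and> sat H U' k a))"
      using Dia.IH by blast
    finally show ?case using Dia.prems by (auto simp: iH mH)
  next
    case (Box a)
    have "sat G U (g i) (Box a) \<longleftrightarrow>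
        (\<forall>u. (g i, u) \<in> ile G \<longrightarrow> (\<forall>v. (u, v) \<in> mle G \<longrightarrow> sat G U v a))"
      by auto
    also have "\<dots> \<longleftrightarrow>
        (\<forall>j<n. (g i, g j) \<in> ile G \<longrightarrow> (\<forall>k<n. (g j, g k) \<in> mle G \<longrightarrow> sat G U (g k) a))"
      by (simp only: il ml')
    also have "\<dots> \<longleftrightarrow> (\<forall>j<n. (g i, g j) \<in> ile G \<longrightarrow> (\<forall>k<n. (g j, g k) \<in> mle G \<longrightarrow> sat H U' k a))"
      using Box.IH by blast
    finally show ?case using Box.prems by (auto simp: iH mH)
  qed (auto simp: H_def U'_def)
  obtain i where i: "i < n" "g i = w" using ex G(4) by blast
  show ?thesis
    by (rule that[OF H _ U, of i]) (use i s in \<open>auto simp: H_def n_def\<close>)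
qed

subsection \<open>Labelled trees\<close>

datatype tree = Node (lab: "fm set") (kids: "tree fset")

abbreviation below :: "tree \<Rightarrow> tree \<Rightarrow> bool" where
  "below t t' \<equiv> (t, t') \<in> {(x, y). y |\<in>| kids x}\<^sup>*"

text \<open>A tree can be added above the root \<open>t\<close> even when its own root has the same label, which strictness
  of labels forbids for a child: then only its children are added.\<close>

definition absorbs :: "tree \<Rightarrow> tree \<Rightarrow> bool" where
  "absorbs t c \<longleftrightarrow> c |\<in>| kids t \<or> (lab c = lab t \<and> kids c |\<subseteq>| kids t)"

primrec subforms :: "fm \<Rightarrow> fm set" where
  "subforms (Var n) = {Var n}"
| "subforms Bot = {Bot}"
| "subforms (And a b) = insert (And a b) (subforms a \<union> subforms b)"
| "subforms (Or a b) = insert (Or a b) (subforms a \<union> subforms b)"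
| "subforms (Imp a b) = insert (Imp a b) (subforms a \<union> subforms b)"
| "subforms (Dia a) = insert (Dia a) (subforms a)"
| "subforms (Box a) = insert (Box a) (subforms a)"

lemma finite_subforms [simp]: "finite (subforms a)"
  by (induction a) auto

lemma subforms_refl [simp]: "a \<in> subforms a"
  by (cases a) auto

lemma subforms_trans: "b \<in> subforms a \<Longrightarrow> subforms b \<subseteq> subforms a"
  by (induction a) auto

locale filtration = S4I_model F V for F :: "'w frame" and V +
  fixes \<phi>0 :: fm
begin

abbreviation "\<Sigma> \<equiv> subforms \<phi>0"

lemma sub_closed:
  "And a b \<in> \<Sigma> \<Longrightarrow> a \<in> \<Sigma> \<and> b \<in> \<Sigma>" "Or a b \<in> \<Sigma> \<Longrightarrow> a \<in> \<Sigma> \<and> b \<in> \<Sigma>"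
  "Imp a b \<in> \<Sigma> \<Longrightarrow> a \<in> \<Sigma> \<and> b \<in> \<Sigma>" "Dia a \<in> \<Sigma> \<Longrightarrow> a \<in> \<Sigma>" "Box a \<in> \<Sigma> \<Longrightarrow> a \<in> \<Sigma>"
  by (drule subforms_trans, simp, metis subforms_refl subsetD)+

definition tp :: "'w \<Rightarrow> fm set" where
  "tp w = {a \<in> \<Sigma>. sat F V w a}"

lemma tp_mono: "(w, v) \<in> ile F \<Longrightarrow> tp w \<subseteq> tp v"
  using sat_mono by (auto simp: tp_def)

lemma tp_subset: "tp w \<subseteq> \<Sigma>"
  by (auto simp: tp_def)

text \<open>A missing implication is either refuted at the root or missing again at a kid. This is a
  local condition, and following it upwards ends at a refuting node because trees are well founded
  (\<open>imp_witness\<close>).\<close>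

inductive real :: "tree \<Rightarrow> 'w \<Rightarrow> bool" where
  "\<lbrakk>w \<in> worlds F; \<And>t. t |\<in>| ts \<Longrightarrow> \<exists>v. (w, v) \<in> ile F \<and> real t v \<and> tp w \<subset> lab t;
    \<And>a b. Imp a b \<in> \<Sigma> - tp w \<Longrightarrow>
      (a \<in> tp w \<and> b \<notin> tp w) \<or> (\<exists>t. t |\<in>| ts \<and> Imp a b \<notin> lab t)\<rbrakk>
   \<Longrightarrow> real (Node (tp w) ts) w"

lemma real_worlds: "real t w \<Longrightarrow> w \<in> worlds F"
  by (erule real.cases) auto

lemma real_lab: "real t w \<Longrightarrow> lab t = tp w"
  by (erule real.cases) auto

lemma real_kid: "real t w \<Longrightarrow> t' |\<in>| kids t \<Longrightarrow> \<exists>v. (w, v) \<in> ile F \<and> real t' v \<and> lab t \<subset> lab t'"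
  by (erule real.cases) auto

lemma real_imp:
  "real t w \<Longrightarrow> Imp a b \<in> \<Sigma> \<Longrightarrow> Imp a b \<notin> lab t \<Longrightarrow>
    (a \<in> lab t \<and> b \<notin> lab t) \<or> (\<exists>t'. t' |\<in>| kids t \<and> Imp a b \<notin> lab t')"
  by (erule real.cases) auto

lemma real_intro:
  assumes "w \<in> worlds F" "lab t = tp w"
    "\<And>t'. t' |\<in>| kids t \<Longrightarrow> \<exists>v. (w, v) \<in> ile F \<and> real t' v \<and> lab t \<subset> lab t'"
    "\<And>a b. Imp a b \<in> \<Sigma> \<Longrightarrow> Imp a b \<notin> lab t \<Longrightarrow>
      (a \<in> lab t \<and> b \<notin> lab t) \<or> (\<exists>t'. t' |\<in>| kids t \<and> Imp a b \<notin> lab t')"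
  shows "real t w"
proof -
  have "real (Node (tp w) (kids t)) w"
    using assms by (intro real.intros) auto
  with assms(2) show ?thesis by (metis tree.collapse)
qed

text \<open>A tree is determined by its label and its finite set of kids. Kids have strictly larger
  labels, so induction on the number of subformulas missing from the label leaves finitely many
  choices for them.\<close>

lemma finite_real: "finite {t. \<exists>w. real t w}"
proof -
  have "finite {t. (\<exists>w. real t w) \<and> card (\<Sigma> - lab t) < k}" for k
  proof (induction k)
    case (Suc k)
    let ?S = "{t. (\<exists>w. real t w) \<and> card (\<Sigma> - lab t) < k}"
    have "t \<in> (\<lambda>(L, ts). Node L ts) ` (Pow \<Sigma> \<times> {ts. fset ts \<subseteq> ?S})"
      if t: "real t w" "card (\<Sigma> - lab t) < Suc k" for t w
    proof -
      have "t' \<in> ?S" if t': "t' |\<in>| kids t" for t'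
      proof -
        obtain v where v: "real t' v" "lab t \<subset> lab t'" using real_kid[OF t(1) t'] by blast
        have "lab t' \<subseteq> \<Sigma>" using real_lab[OF v(1)] tp_subset by auto
        then have "\<Sigma> - lab t' \<subset> \<Sigma> - lab t" using v(2) by blast
        then have "card (\<Sigma> - lab t') < card (\<Sigma> - lab t)" by (intro psubset_card_mono) auto
        with t(2) v(1) show ?thesis by auto
      qed
      moreover have "lab t \<subseteq> \<Sigma>" using real_lab[OF t(1)] tp_subset by auto
      ultimately have "(lab t, kids t) \<in> Pow \<Sigma> \<times> {ts. fset ts \<subseteq> ?S}" by auto
      then show ?thesis by (rule rev_image_eqI) simp
    qed
    then have "{t. (\<exists>w. real t w) \<and> card (\<Sigma> - lab t) < Suc k}
        \<subseteq> (\<lambda>(L, ts). Node L ts) ` (Pow \<Sigma> \<times> {ts. fset ts \<subseteq> ?S})"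
      by blast
    moreover have "finite {ts. fset ts \<subseteq> ?S}"
    proof -
      \<comment> \<open>Finite sets over \<open>?S\<close> form the preimage of a powerset under the
        injection \<open>fset\<close>.\<close>
      have "finite (fset -` Pow ?S)" using Suc by (intro finite_vimageI) (auto simp: inj_on_def fset_inject)
      then show ?thesis by (simp add: vimage_def)
    qed
    ultimately show ?case by (meson finite_SigmaI finite_Pow_iff finite_imageI finite_subset finite_subforms)
  qed simp
  from this[of "Suc (card \<Sigma>)"] show ?thesis
    by (rule rev_finite_subset) (auto intro!: le_imp_less_Suc card_mono)
qed

subsection \<open>Realising trees\<close>

text \<open>Induction on the number of subformulas that \<open>w\<close> does not satisfy: an
  implication that fails at \<open>w\<close> without being refuted there is refuted at a world of
  strictly larger type, where the induction hypothesis supplies a tree. The set \<open>C\<close>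
  lets later constructions prescribe continuations.\<close>

lemma tree_exists:
  assumes "w \<in> worlds F" "finite C" "\<And>c. c \<in> C \<Longrightarrow> \<exists>v. (w, v) \<in> ile F \<and> real c v"
  shows "\<exists>t. real t w \<and> (\<forall>c\<in>C. absorbs t c)"
  using assms
proof (induction "card (\<Sigma> - tp w)" arbitrary: w C rule: less_induct)
  case less
  define I where "I = {(a, b). Imp a b \<in> \<Sigma> - tp w \<and> \<not> (a \<in> tp w \<and> b \<notin> tp w)}"
  have "finite ((\<lambda>(a, b). Imp a b) -` \<Sigma>)"
    by (intro finite_vimageI) (auto simp: inj_on_def)
  then have finI: "finite I" by (rule rev_finite_subset) (auto simp: I_def)
  have "\<exists>t v. real t v \<and> (w, v) \<in> ile F \<and> tp w \<subset> tp v \<and> Imp (fst i) (snd i) \<notin> lab t" if i: "i \<in> I" for i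
  proof -
    obtain a b where ab: "i = (a, b)" by (cases i)
    with i have *: "Imp a b \<in> \<Sigma>" "\<not> sat F V w (Imp a b)" by (auto simp: I_def tp_def)
    then obtain v where v: "(w, v) \<in> ile F" "sat F V v a" "\<not> sat F V v b" by auto
    have "a \<in> tp v" "b \<notin> tp v" using v sub_closed(3)[OF *(1)] by (auto simp: tp_def)
    \<comment> \<open>At \<open>v\<close> the antecedent holds and the consequent fails, which
      membership in \<open>I\<close> excludes at \<open>w\<close>.\<close>
    with i ab have ne: "tp w \<noteq> tp v" by (auto simp: I_def)
    with tp_mono[OF v(1)] have lt: "tp w \<subset> tp v" by blast
    have "\<Sigma> - tp v \<subset> \<Sigma> - tp w" using lt tp_subset[of v] by blast
    then have "card (\<Sigma> - tp v) < card (\<Sigma> - tp w)" by (intro psubset_card_mono) auto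
    from less.hyps[OF this, of "{}"] obtain t where t: "real t v"
      using v(1) ile_worlds by blast
    have "\<not> sat F V v (Imp a b)" using v sat_Imp_mp ile_worlds by blast
    then have "Imp a b \<notin> lab t" using real_lab[OF t] by (auto simp: tp_def)
    with t v(1) lt ab show ?thesis by auto
  qed
  then obtain T v where T: "\<And>i. i \<in> I \<Longrightarrow> real (T i) (v i) \<and> (w, v i) \<in> ile F \<and> tp w \<subset> tp (v i) \<and>
      Imp (fst i) (snd i) \<notin> lab (T i)" by metis
  \<comment> \<open>A tree of \<open>C\<close> whose label is the type of \<open>w\<close> would
    violate strictness as a kid. Its own kids take its place; they are still realised above
    \<open>w\<close> by transitivity.\<close>
  define K where "K = T ` I \<union> {c \<in> C. lab c \<noteq> tp w} \<union>
    (\<Union>c\<in>{c \<in> C. lab c = tp w}. fset (kids c))"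
  have finK: "finite K" using finI less.prems(2) by (auto simp: K_def)
  define t where "t = Node (tp w) (Abs_fset K)"
  have kt: "c |\<in>| kids t \<longleftrightarrow> c \<in> K" for c using finK by (simp add: t_def Abs_fset_inverse)
  have "real t w"
  proof (rule real_intro)
    show "w \<in> worlds F" by fact
    show lt: "lab t = tp w" by (simp add: t_def)
    fix t' assume "t' |\<in>| kids t"
    then consider i where "i \<in> I" "t' = T i" | "t' \<in> C" "lab t' \<noteq> tp w"
      | c where "c \<in> C" "lab c = tp w" "t' |\<in>| kids c"
      unfolding kt K_def by auto
    then show "\<exists>v. (w, v) \<in> ile F \<and> real t' v \<and> lab t \<subset> lab t'"
    proof cases
      case 1
      with T[of i] lt real_lab[of "T i" "v i"] show ?thesis by auto
    next
      case 2
      then obtain v where "(w, v) \<in> ile F" "real t' v" using less.prems(3) by blast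
      with 2 lt real_lab tp_mono show ?thesis by (metis psubsetI)
    next
      case 3
      then obtain v where "(w, v) \<in> ile F" "real c v" using less.prems(3) by blast
      with real_kid[of c v t'] 3 lt ile_trans show ?thesis by metis
    qed
  next
    fix a b assume *: "Imp a b \<in> \<Sigma>" "Imp a b \<notin> lab t"
    show "a \<in> lab t \<and> b \<notin> lab t \<or> (\<exists>t'. t' |\<in>| kids t \<and> Imp a b \<notin> lab t')"
    proof (cases "(a, b) \<in> I")
      case True
      then have "T (a, b) \<in> K" by (simp add: K_def)
      with T[OF True] show ?thesis by (auto simp: kt)
    qed (use * in \<open>auto simp: I_def t_def\<close>)
  qed
  moreover have "absorbs t c" if "c \<in> C" for c
  proof (cases "lab c = tp w")
    case True
    have "x |\<in>| kids t" if "x |\<in>| kids c" for x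
      unfolding kt K_def using that True \<open>c \<in> C\<close> by blast
    then show ?thesis using True by (auto simp: absorbs_def t_def)
  next
    case False
    then have "c \<in> K" using that by (simp add: K_def)
    then show ?thesis by (simp add: absorbs_def kt)
  qed
  ultimately show ?case by blast
qed

subsection \<open>Simulations\<close>

text \<open>Passing on \<open>Box a\<close> and \<open>Dia a\<close> themselves, and not only
  \<open>a\<close>, makes the relation transitive. The diamond clause is guarded because it puts a
  formula into \<open>L\<close> that may lie outside the subformulas.\<close>

definition sensible :: "fm set \<Rightarrow> fm set \<Rightarrow> bool" where
  "sensible L L' \<longleftrightarrow> (\<forall>a. Box a \<in> L \<longrightarrow> a \<in> L' \<and> Box a \<in> L') \<and>
    (\<forall>a. Dia a \<in> \<Sigma> \<longrightarrow> a \<in> L' \<or> Dia a \<in> L' \<longrightarrow> Dia a \<in> L)"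

lemma sensible_trans: "sensible L L' \<Longrightarrow> sensible L' L'' \<Longrightarrow> sensible L L''"
  unfolding sensible_def by blast

lemma sensible_tp:
  assumes "(w, v) \<in> mle F"
  shows "sensible (tp w) (tp v)"
  unfolding sensible_def
proof (intro conjI allI impI)
  note wv = mle_worlds[OF assms]
  show "a \<in> tp v" if "Box a \<in> tp w" for a
    using that sat_Box_iff wv assms sub_closed(5) unfolding tp_def by blast
  show "Box a \<in> tp v" if "Box a \<in> tp w" for a
    using that sat_Box_iff wv mle_trans[OF assms] unfolding tp_def by blast
  show "Dia a \<in> tp w" if "Dia a \<in> \<Sigma>" "a \<in> tp v \<or> Dia a \<in> tp v" for a
    using that sat_Dia_iff wv assms mle_trans[OF assms] unfolding tp_def by blast
qed

text \<open>A kid may be matched to any node of the target, even to its root, so a simulation can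
  stall where the labels of the target do not grow.\<close>

inductive sim :: "tree \<Rightarrow> tree \<Rightarrow> bool" where
  "\<lbrakk>sensible L (lab s); \<And>t'. t' |\<in>| ts \<Longrightarrow> \<exists>s'. below s s' \<and> sim t' s'\<rbrakk> \<Longrightarrow> sim (Node L ts) s"

lemma sim_lab: "sim t s \<Longrightarrow> sensible (lab t) (lab s)"
  by (erule sim.cases) auto

lemma sim_kid: "sim t s \<Longrightarrow> t' |\<in>| kids t \<Longrightarrow> \<exists>s'. below s s' \<and> sim t' s'"
  by (erule sim.cases) auto

lemma sim_below: "below t t' \<Longrightarrow> sim t s \<Longrightarrow> \<exists>s'. below s s' \<and> sim t' s'"
proof (induction rule: rtrancl_induct)
  case base
  then show ?case by blast
next
  case (step y z)
  then obtain s' where s': "below s s'" "sim y s'" by blast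
  from step have "z |\<in>| kids y" by simp
  from sim_kid[OF s'(2) this] s'(1) show ?case by (meson rtrancl_trans)
qed

lemma sim_trans: "sim t s \<Longrightarrow> sim s u \<Longrightarrow> sim t u"
proof (induction arbitrary: u rule: sim.induct)
  case (1 L s ts)
  show ?case
  proof (rule sim.intros)
    show "sensible L (lab u)" using 1(1) sim_lab[OF 1(3)] by (rule sensible_trans)
    fix t' assume "t' |\<in>| ts"
    with 1(2) obtain s' where s': "below s s'" "\<And>u. sim s' u \<Longrightarrow> sim t' u" by blast
    from sim_below[OF s'(1) 1(3)] s'(2) show "\<exists>u'. below u u' \<and> sim t' u'" by blast
  qed
qed

text \<open>Realisation matters here: a label is \<open>sensible\<close> to itself because the modal
  relation is reflexive at the world behind it.\<close>

lemma sim_refl: "real t w \<Longrightarrow> sim t t"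
proof (induction rule: real.induct)
  case (1 w ts)
  show ?case
  proof (rule sim.intros)
    show "sensible (tp w) (lab (Node (tp w) ts))" using sensible_tp[OF mle_refl] 1(1) by simp
    fix t' assume t': "t' |\<in>| ts"
    then have "below (Node (tp w) ts) t'" by (intro r_into_rtrancl) simp
    then show "\<exists>s'. below (Node (tp w) ts) s' \<and> sim t' s'" using 1 t' by blast
  qed
qed

text \<open>The root of \<open>c\<close> need not occur in \<open>s\<close>: kids matched to that
  root are redirected to \<open>s\<close> by the induction hypothesis, and all other matches lie
  below a kid that \<open>c\<close> shares with \<open>s\<close>.\<close>

lemma sim_same:
  "sim t c \<Longrightarrow> lab c = lab s \<Longrightarrow> kids c |\<subseteq>| kids s \<Longrightarrow> sim t s"
proof (induction t c rule: sim.induct)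
  case (1 L c ts)
  show ?case
  proof (rule sim.intros)
    show "sensible L (lab s)" using 1 by simp
    fix t' assume "t' |\<in>| ts"
    with 1(2) obtain s' where s': "below c s'" "sim t' s'"
        "lab s' = lab s \<Longrightarrow> kids s' |\<subseteq>| kids s \<Longrightarrow> sim t' s" by blast
    from s'(1) show "\<exists>s'. below s s' \<and> sim t' s'"
    proof (cases rule: converse_rtranclE)
      case base
      then show ?thesis using s'(3) 1(3,4) by blast
    next
      case (step y)
      then have "below s y" using 1(4) by (intro r_into_rtrancl) auto
      with step show ?thesis using s'(2) by (meson rtrancl_trans)
    qed
  qed
qed

lemma sim_absorbs:
  assumes "sim t c" "absorbs s c"
  shows "\<exists>s'. below s s' \<and> sim t s'"
  using assms(2) unfolding absorbs_def
proof
  assume "c |\<in>| kids s"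
  then have "below s c" by (intro r_into_rtrancl) simp
  with assms(1) show ?thesis by blast
next
  assume "lab c = lab s \<and> kids c |\<subseteq>| kids s"
  then have "sim t s" using sim_same[OF assms(1)] by blast
  then show ?thesis by blast
qed

text \<open>Upward confluence moves the world of each kid to a world above \<open>v\<close>;
  \<open>tree_exists\<close> then gathers the simulating trees, together with \<open>C\<close>,
  under one root. The statement quantifies over \<open>v\<close> and \<open>C\<close> in the object
  logic because the induction hypothesis occurs under an existential quantifier.\<close>

lemma sim_exists_aux:
  "real t w \<Longrightarrow> \<forall>v C. (w, v) \<in> mle F \<longrightarrow> finite C \<longrightarrow>
    (\<forall>c\<in>C. \<exists>u. (v, u) \<in> ile F \<and> real c u) \<longrightarrow>
    (\<exists>s. real s v \<and> sim t s \<and> (\<forall>c\<in>C. absorbs s c))"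
proof (induction rule: real.induct)
  case (1 w ts)
  show ?case
  proof (intro allI impI)
    fix v C
    assume prems: "(w, v) \<in> mle F" "finite C" "\<forall>c\<in>C. \<exists>u. (v, u) \<in> ile F \<and> real c u"
    have "\<exists>s u. (v, u) \<in> ile F \<and> real s u \<and> sim t s" if t: "t |\<in>| ts" for t
    proof -
      from "1.IH"[OF t] obtain x where x: "(w, x) \<in> ile F"
        "\<forall>v C. (x, v) \<in> mle F \<longrightarrow> finite C \<longrightarrow>
            (\<forall>c\<in>C. \<exists>u. (v, u) \<in> ile F \<and> real c u) \<longrightarrow>
            (\<exists>s. real s v \<and> sim t s \<and> (\<forall>c\<in>C. absorbs s c))"
        by (elim exE conjE) (rule that)
      obtain u where u: "(v, u) \<in> ile F" "(x, u) \<in> mle F" by (rule forth_upE[OF x(1) prems(1)])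
      from x(2)[rule_format, OF u(2), of "{}"] u(1) show ?thesis by auto
    qed
    then obtain S u where S: "\<And>t. t |\<in>| ts \<Longrightarrow> (v, u t) \<in> ile F \<and> real (S t) (u t) \<and> sim t (S t)" by metis
    have v: "v \<in> worlds F" using mle_worlds prems(1) by blast
    have "\<exists>s. real s v \<and> (\<forall>c\<in>C \<union> S ` fset ts. absorbs s c)"
      by (rule tree_exists) (use v prems(2,3) S in auto)
    then obtain s where s: "real s v" "\<And>c. c \<in> C \<union> S ` fset ts \<Longrightarrow> absorbs s c" by blast
    have "sim (Node (tp w) ts) s"
    proof (rule sim.intros)
      show "sensible (tp w) (lab s)" using sensible_tp[OF prems(1)] real_lab[OF s(1)] by simp
      fix t assume t: "t |\<in>| ts"
      with S have "sim t (S t)" by blast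
      moreover have "absorbs s (S t)" using s(2) t by blast
      ultimately show "\<exists>s'. below s s' \<and> sim t s'" by (rule sim_absorbs)
    qed
    with s show "\<exists>s. real s v \<and> sim (Node (tp w) ts) s \<and> (\<forall>c\<in>C. absorbs s c)" by blast
  qed
qed

lemma sim_exists:
  "real t w \<Longrightarrow> (w, v) \<in> mle F \<Longrightarrow> finite C \<Longrightarrow>
    (\<And>c. c \<in> C \<Longrightarrow> \<exists>u. (v, u) \<in> ile F \<and> real c u) \<Longrightarrow>
    \<exists>s. real s v \<and> sim t s \<and> (\<forall>c\<in>C. absorbs s c)"
  using sim_exists_aux by simp

subsection \<open>The finite frame of paths\<close>

text \<open>Paths are lists with the current node first, so that the initial segments of a path are the
  suffixes of the list.\<close>

inductive path :: "tree list \<Rightarrow> 'w \<Rightarrow> bool" where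
  single: "real t w \<Longrightarrow> path [t] w"
| step: "\<lbrakk>path (t # p) w; t' |\<in>| kids t; (w, v) \<in> ile F; real t' v\<rbrakk> \<Longrightarrow> path (t' # t # p) v"

text \<open>\<open>q'\<close> may be all of \<open>q\<close>, so several nodes can share a match.
  Heads are always matched to heads, since the modal clauses of the truth lemma compare
  heads.\<close>

primrec psim :: "tree list \<Rightarrow> tree list \<Rightarrow> bool" where
  "psim [] q \<longleftrightarrow> True"
| "psim (t # p) q \<longleftrightarrow> q \<noteq> [] \<and> sim t (hd q) \<and> (\<exists>q'. suffix q' q \<and> psim p q')"

lemma path_real: "path p w \<Longrightarrow> real (hd p) w"
  by (erule path.cases) auto

lemma path_tl: "path (t # p) w \<Longrightarrow> p \<noteq> [] \<Longrightarrow> \<exists>v. path p v"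
  by (erule path.cases) auto

lemma path_tl_kid: "path (t' # t # p) w \<Longrightarrow> t' |\<in>| kids t"
  by (erule path.cases) auto

lemma path_suffix: "path (r @ p) w \<Longrightarrow> p \<noteq> [] \<Longrightarrow> \<exists>v. path p v"
proof (induction r arbitrary: w)
  case (Cons t r)
  then show ?case using path_tl[of t "r @ p" w] by auto
qed auto

lemma path_below:
  "below t s \<Longrightarrow> path (t # p) w \<Longrightarrow> \<exists>r v. path (s # r @ p) v \<and> suffix (t # p) (s # r @ p)"
proof (induction rule: rtrancl_induct)
  case base
  then show ?case by (intro exI[of _ "[]"]) auto
next
  case (step y z)
  then obtain r v where r: "path (y # r @ p) v" "suffix (t # p) (y # r @ p)" by blast
  obtain u where "(v, u) \<in> ile F" "real z u"
    using real_kid[OF path_real[OF r(1)], of z] step(2) by auto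
  with r step(2) have "path (z # (y # r) @ p) u" by (auto intro: path.step)
  moreover have "suffix (t # p) (z # (y # r) @ p)" using r(2) by (simp add: suffix_ConsI)
  ultimately show ?case by blast
qed

lemma psim_suffix: "psim p q \<Longrightarrow> suffix p' p \<Longrightarrow> \<exists>q'. suffix q' q \<and> psim p' q'"
proof (induction p arbitrary: q)
  case (Cons t p)
  show ?case
  proof (cases "p' = t # p")
    case True
    then show ?thesis using Cons(2) by blast
  next
    case False
    then have "suffix p' p" using Cons(3) by (simp add: suffix_Cons)
    moreover obtain q' where "suffix q' q" "psim p q'" using Cons(2) by auto
    ultimately show ?thesis using Cons.IH by (meson suffix_order.trans)
  qed
qed auto

lemma psim_hd: "psim p q \<Longrightarrow> p \<noteq> [] \<Longrightarrow> q \<noteq> [] \<and> sim (hd p) (hd q)"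
  by (cases p) auto

lemma psim_trans: "psim p q \<Longrightarrow> psim q r \<Longrightarrow> psim p r"
proof (induction p arbitrary: q r)
  case (Cons t p)
  then obtain q' where q: "q \<noteq> []" "sim t (hd q)" "suffix q' q" "psim p q'" by auto
  from psim_suffix[OF Cons(3) q(3)] obtain r' where r': "suffix r' r" "psim q' r'" by blast
  have "psim p r'" using Cons.IH q(4) r'(2) by blast
  moreover have "sim t (hd r)" "r \<noteq> []" using psim_hd[OF Cons(3) q(1)] q(2) sim_trans by blast+
  ultimately show ?case using r'(1) by auto
qed simp

lemma psim_refl: "path p w \<Longrightarrow> psim p p"
proof (induction rule: path.induct)
  case (single t w)
  then show ?case using sim_refl by auto
next
  case (step t p w t' v)
  have "suffix (t # p) (t' # t # p)" by (simp add: suffix_ConsI)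
  then show ?case using step(5) sim_refl[OF step(4)] by (simp del: psim.simps add: psim.simps(2)[of t']) blast
qed

text \<open>The tree for the head is built first, over \<open>v\<close>. Downward confluence then
  moves one step towards the root, where the induction hypothesis is asked for a path whose head
  absorbs that tree. If it is absorbed without becoming a kid, the path is not prolonged; hence
  \<open>q\<close> ends at a world \<open>u\<close> merely below \<open>v\<close>, though with the
  type of \<open>v\<close>.\<close>

lemma psim_exists:
  "path p w \<Longrightarrow> (w, v) \<in> mle F \<Longrightarrow> finite C \<Longrightarrow>
    (\<And>c. c \<in> C \<Longrightarrow> \<exists>u. (v, u) \<in> ile F \<and> real c u) \<Longrightarrow>
    \<exists>q u. path q u \<and> (u, v) \<in> ile F \<and> lab (hd q) = tp v \<and> psim p q \<and> (\<forall>c\<in>C. absorbs (hd q) c)"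
proof (induction arbitrary: v C rule: path.induct)
  case (single t w)
  then obtain s where s: "real s v" "sim t s" "\<forall>c\<in>C. absorbs s c" using sim_exists by metis
  have "v \<in> worlds F" using mle_worlds single(2) by blast
  then show ?case using s real_lab[OF s(1)] ile_refl
    by (intro exI[of _ "[s]"] exI[of _ v]) (auto intro: path.single)
next
  case (step t p w t' v0)
  obtain s where s: "real s v" "sim t' s" "\<forall>c\<in>C. absorbs s c"
    using sim_exists[OF step(4,6,7,8)] by blast
  obtain v1 where v1: "(w, v1) \<in> mle F" "(v1, v) \<in> ile F" by (rule forth_downE[OF step(3,6)])
  have "\<exists>q u. path q u \<and> (u, v1) \<in> ile F \<and> lab (hd q) = tp v1 \<and> psim (t # p) q \<and>
      (\<forall>c\<in>{s}. absorbs (hd q) c)"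
    by (rule step.IH) (use v1 s in auto)
  then obtain q u where q: "path q u" "(u, v1) \<in> ile F" "lab (hd q) = tp v1" "psim (t # p) q"
    "absorbs (hd q) s" by blast
  have uv: "(u, v) \<in> ile F" using q(2) v1(2) by (rule ile_trans)
  have v: "v \<in> worlds F" using mle_worlds step(6) by blast
  obtain h r where hr: "q = h # r" using q(1) by (cases q) auto
  from q(5) consider "s |\<in>| kids h" | "lab s = lab h" "kids s |\<subseteq>| kids h"
    unfolding hr absorbs_def by auto
  then show ?case
  proof cases
    case 1
    then have "path (s # q) v" using q(1) uv s(1) unfolding hr by (blast intro: path.step)
    moreover have "psim (t' # t # p) (s # q)"
      using s(2) q(4) suffix_ConsI[of q q s] by (subst psim.simps(2)) auto
    ultimately show ?thesis using s real_lab[OF s(1)] ile_refl[OF v]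
      by (intro exI[of _ "s # q"] exI[of _ v]) auto
  next
    case 2
    \<comment> \<open>The stalled case: the simulation of \<open>t'\<close> by \<open>s\<close>
      transfers to \<open>h\<close>, so \<open>t'\<close> and \<open>t\<close> are both matched to
      \<open>h\<close>.\<close>
    have "psim (t' # t # p) q"
      using sim_same[OF s(2) 2] q(4) hr by (subst psim.simps(2)) auto
    moreover have "absorbs h c" if "c \<in> C" for c
      using s(3) that 2 unfolding absorbs_def by (metis fsubsetD order_trans)
    ultimately show ?thesis using q(1) uv 2(1) real_lab[OF s(1)] hr
      by (intro exI[of _ q] exI[of _ u] conjI ballI) simp_all
  qed
qed

section \<open>Finiteness and confluence of the frame of paths\<close>

lemma finite_paths: "finite {p. \<exists>w. path p w}"
proof -
  let ?S = "{t. \<exists>w. real t w}"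
  \<comment> \<open>Strict growth of labels forbids repeating a tree, and a finite set has finitely
    many lists without repetition.\<close>
  have "set p \<subseteq> ?S \<and> distinct p \<and> (\<forall>t\<in>set (tl p). lab t \<subset> lab (hd p))" if "path p w" for p w
    using that
  proof (induction rule: path.induct)
    case (step t p w t' v)
    have "lab t \<subset> lab t'" using real_kid[OF path_real[OF step(1)], of t'] step(2) by auto
    then show ?case using step by fastforce
  qed auto
  then have "{p. \<exists>w. path p w} \<subseteq> {p. set p \<subseteq> ?S \<and> distinct p}" by blast
  then show ?thesis by (rule finite_subset) (rule finite_subset_distinct[OF finite_real])
qed

definition paths :: "tree list set" where
  "paths = {p. \<exists>w. path p w}"

definition pframe :: "tree list frame" where
  "pframe = \<lparr>worlds = paths, fallible = {},
     ile = {(p, q). p \<in> paths \<and> q \<in> paths \<and> suffix p q},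
     mle = {(p, q). p \<in> paths \<and> q \<in> paths \<and> psim p q}\<rparr>"

definition pval :: "nat \<Rightarrow> tree list set" where
  "pval n = {p \<in> paths. Var n \<in> lab (hd p)}"

lemma pframe_simps [simp]:
  "worlds pframe = paths" "fallible pframe = {}"
  "(p, q) \<in> ile pframe \<longleftrightarrow> p \<in> paths \<and> q \<in> paths \<and> suffix p q"
  "(p, q) \<in> mle pframe \<longleftrightarrow> p \<in> paths \<and> q \<in> paths \<and> psim p q"
  by (auto simp: pframe_def)

lemma path_lab_mono: "path p w \<Longrightarrow> suffix q p \<Longrightarrow> q \<noteq> [] \<Longrightarrow> lab (hd q) \<subseteq> lab (hd p)"
proof (induction rule: path.induct)
  case (step t p w t' v)
  have "lab t \<subset> lab t'" using real_kid[OF path_real[OF step(1)], of t'] step(2) by auto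
  then show ?case using step by (auto simp: suffix_Cons)
qed (auto simp: suffix_Cons)

text \<open>Each new node is a kid of the current head, and the simulation offers a match among the
  descendants of the matched head; the path is prolonged to that descendant.\<close>

lemma psim_extend:
  "path (r @ p) w \<Longrightarrow> p \<noteq> [] \<Longrightarrow> psim p q \<Longrightarrow> q \<in> paths \<Longrightarrow>
    \<exists>q'\<in>paths. suffix q q' \<and> psim (r @ p) q'"
proof (induction r arbitrary: w)
  case (Cons t r)
  then obtain w' where w': "path (r @ p) w'" using path_tl[of t "r @ p" w] by auto
  from Cons.IH[OF this Cons(3-5)] obtain q' where q': "q' \<in> paths" "suffix q q'" "psim (r @ p) q'"
    by blast
  obtain h l where hl: "r @ p = h # l" using Cons(3) by (cases "r @ p") auto
  have q'ne: "q' \<noteq> []" and sh: "sim h (hd q')" using psim_hd[OF q'(3)] hl by auto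
  obtain k m where km: "q' = k # m" using q'ne by (cases q') auto
  have "t |\<in>| kids h" using path_tl_kid[of t h l w] Cons(2) hl by simp
  from sim_kid[OF sh this] obtain s where s: "below k s" "sim t s" using km by auto
  obtain u where "path (k # m) u" using q'(1) km by (auto simp: paths_def)
  from path_below[OF s(1) this] obtain z v where z: "path (s # z @ m) v" "suffix (k # m) (s # z @ m)"
    by blast
  have "psim ((t # r) @ p) (s # z @ m)"
    using s(2) z(2) q'(3) km by auto
  moreover have "suffix q (s # z @ m)" using q'(2) z(2) km by (metis suffix_order.trans)
  ultimately show ?case using z(1) by (auto simp: paths_def)
qed auto

lemma paths_ne: "p \<in> paths \<Longrightarrow> p \<noteq> []"
  by (auto simp: paths_def elim: path.cases)

lemma pframe_S4I: "S4I_frame pframe"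
proof -
  have "preorder_on (worlds pframe) (ile pframe)"
    unfolding preorder_on_def refl_on_def trans_on_def by (auto intro: suffix_order.trans)
  moreover have "psim p p" if "p \<in> paths" for p
    using that psim_refl by (auto simp: paths_def)
  then have "preorder_on (worlds pframe) (mle pframe)"
    unfolding preorder_on_def refl_on_def trans_on_def
    by (auto simp del: psim.simps) (metis psim_trans)
  moreover have "forth_up pframe"
    unfolding forth_up_def
  proof (intro allI impI)
    fix p p' q assume *: "(p, p') \<in> ile pframe" "(p, q) \<in> mle pframe"
    then obtain r where r: "p' = r @ p" by (auto simp: suffix_def)
    obtain w where "path (r @ p) w" using * r by (auto simp: paths_def)
    moreover have "p \<noteq> []" "psim p q" "q \<in> paths" using * paths_ne by simp_all
    ultimately obtain q' where "q' \<in> paths" "suffix q q'" "psim (r @ p) q'"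
      using psim_extend by blast
    with * r show "\<exists>q'. (q, q') \<in> ile pframe \<and> (p', q') \<in> mle pframe" by auto
  qed
  moreover have "forth_down pframe"
    unfolding forth_down_def
  proof (intro allI impI)
    fix p p' q assume *: "(p, p') \<in> ile pframe" "(p', q) \<in> mle pframe"
    then obtain q' where q': "suffix q' q" "psim p q'" using psim_suffix[of p' q p] by auto
    have "q' \<noteq> []" using psim_hd[OF q'(2)] paths_ne * by auto
    moreover obtain r w where "path (r @ q') w" using q'(1) * by (auto simp: paths_def suffix_def)
    ultimately have "q' \<in> paths" using path_suffix by (auto simp: paths_def)
    with q' * show "\<exists>q'. (p, q') \<in> mle pframe \<and> (q', q) \<in> ile pframe" by auto
  qed
  ultimately show ?thesis
    by (simp add: S4I_frame_def bi_frame_def infallible_def up_closed_def)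
qed

lemma pval_valuation: "valuation pframe pval"
proof -
  have "Var n \<in> lab (hd q)" if pq: "p \<in> paths" "q \<in> paths" "suffix p q" "Var n \<in> lab (hd p)" for n p q
  proof -
    obtain w where w: "path q w" using pq(2) by (auto simp: paths_def)
    from path_lab_mono[OF w pq(3) paths_ne[OF pq(1)]] pq(4) show ?thesis by blast
  qed
  then show ?thesis by (auto simp: valuation_def up_closed_def pval_def)
qed

lemmas pframe_model = S4I_model.intro[OF pframe_S4I pval_valuation]

section \<open>Truth lemma for paths and the finite frame property\<close>

lemma imp_witness:
  "real t w \<Longrightarrow> Imp a b \<in> \<Sigma> \<Longrightarrow> Imp a b \<notin> lab t \<Longrightarrow>
    \<exists>s. below t s \<and> a \<in> lab s \<and> b \<notin> lab s"
proof (induction t arbitrary: w)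
  case (Node L ts)
  have "(a \<in> L \<and> b \<notin> L) \<or> (\<exists>t. t |\<in>| ts \<and> Imp a b \<notin> lab t)"
    using real_imp[OF Node.prems] by simp
  then show ?case
  proof (elim disjE exE conjE)
    assume "a \<in> L" "b \<notin> L"
    then show ?thesis by (intro exI[of _ "Node L ts"]) simp
  next
    fix t assume t: "t |\<in>| ts" "Imp a b \<notin> lab t"
    obtain v where "real t v" using real_kid[OF Node.prems(1), of t] t(1) by auto
    from Node.IH[OF t(1) this Node.prems(2) t(2)] obtain s where
      s: "below t s" "a \<in> lab s \<and> b \<notin> lab s" by blast
    have "below (Node L ts) t" using t(1) by (intro r_into_rtrancl) simp
    with s show ?thesis by (meson rtrancl_trans)
  qed
qed

lemma truth: "a \<in> \<Sigma> \<Longrightarrow> p \<in> paths \<Longrightarrow> sat pframe pval p a \<longleftrightarrow> a \<in> lab (hd p)"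
proof (induction a arbitrary: p)
  case (Var n)
  then show ?case by (simp add: pval_def)
next
  case Bot
  then obtain w where w: "path p w" by (auto simp: paths_def)
  then show ?case using real_lab[OF path_real[OF w]] by (simp add: tp_def)
next
  case (And a b)
  obtain w where w: "path p w" using And.prems by (auto simp: paths_def)
  have ab: "a \<in> \<Sigma>" "b \<in> \<Sigma>" using sub_closed(1)[OF And.prems(1)] by auto
  show ?case using real_lab[OF path_real[OF w]] And.prems And.IH(1)[OF ab(1)] And.IH(2)[OF ab(2)] ab
    by (simp add: tp_def)
next
  case (Or a b)
  obtain w where w: "path p w" using Or.prems by (auto simp: paths_def)
  have ab: "a \<in> \<Sigma>" "b \<in> \<Sigma>" using sub_closed(2)[OF Or.prems(1)] by auto
  show ?case using real_lab[OF path_real[OF w]] Or.prems Or.IH(1)[OF ab(1)] Or.IH(2)[OF ab(2)] ab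
    by (simp add: tp_def)
next
  case (Imp a b)
  note IH = Imp.IH(1)[OF conjunct1[OF sub_closed(3)[OF Imp.prems(1)]]]
    Imp.IH(2)[OF conjunct2[OF sub_closed(3)[OF Imp.prems(1)]]]
  obtain w where w: "path p w" using Imp.prems by (auto simp: paths_def)
  show ?case
  proof
    assume *: "Imp a b \<in> lab (hd p)"
    show "sat pframe pval p (Imp a b)"
      unfolding sat.simps
    proof (intro allI impI)
      fix q assume q: "(p, q) \<in> ile pframe" "sat pframe pval q a"
      obtain u where u: "path q u" using q by (auto simp: paths_def)
      have lq: "lab (hd q) = tp u" using real_lab[OF path_real[OF u]] .
      have "Imp a b \<in> lab (hd q)" using path_lab_mono[OF u, of p] q * paths_ne Imp.prems(2) by auto
      moreover have "a \<in> lab (hd q)" using IH(1) q by simp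
      ultimately have "b \<in> lab (hd q)"
        using sat_Imp_mp real_worlds[OF path_real[OF u]] sub_closed(3)[OF Imp.prems(1)]
        unfolding lq tp_def by blast
      then show "sat pframe pval q b" using IH(2) q by simp
    qed
  next
    assume s: "sat pframe pval p (Imp a b)"
    show "Imp a b \<in> lab (hd p)"
    proof (rule ccontr)
      assume "Imp a b \<notin> lab (hd p)"
      from imp_witness[OF path_real[OF w] Imp.prems(1) this] obtain t where
        t: "below (hd p) t" "a \<in> lab t" "b \<notin> lab t" by blast
      obtain h l where hl: "p = h # l" using paths_ne[OF Imp.prems(2)] by (cases p) auto
      from path_below[of h t l w] t w hl obtain r v where
        r: "path (t # r @ l) v" "suffix p (t # r @ l)" by auto
      then have q: "t # r @ l \<in> paths" by (auto simp: paths_def)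
      with r Imp.prems(2) have "(p, t # r @ l) \<in> ile pframe" by simp
      with s IH(1,2)[OF q] t show False by auto
    qed
  qed
next
  case (Dia a)
  have a: "a \<in> \<Sigma>" using sub_closed(4) Dia.prems by blast
  obtain w where w: "path p w" using Dia.prems by (auto simp: paths_def)
  have lp: "lab (hd p) = tp w" using real_lab[OF path_real[OF w]] .
  have "sat pframe pval p (Dia a) \<longleftrightarrow> (\<exists>q\<in>paths. psim p q \<and> a \<in> lab (hd q))"
    using S4I_model.sat_Dia_iff[OF pframe_model, of p a] Dia.prems Dia.IH[OF a] by (auto simp del: sat.simps)
  also have "\<dots> \<longleftrightarrow> Dia a \<in> lab (hd p)"
  proof
    assume "\<exists>q\<in>paths. psim p q \<and> a \<in> lab (hd q)"
    then show "Dia a \<in> lab (hd p)"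
      using psim_hd paths_ne Dia.prems sim_lab unfolding sensible_def by blast
  next
    assume "Dia a \<in> lab (hd p)"
    then have "sat F V w (Dia a)" unfolding lp by (simp add: tp_def)
    then obtain v where v: "(w, v) \<in> mle F" "sat F V v a"
      using sat_Dia_iff real_worlds[OF path_real[OF w]] by blast
    \<comment> \<open>It is harmless that this path may end below \<open>v\<close>: its head carries
      the type of \<open>v\<close>.\<close>
    obtain q u where "path q u" "lab (hd q) = tp v" "psim p q"
      using psim_exists[OF w v(1), of "{}"] by auto
    with v a show "\<exists>q\<in>paths. psim p q \<and> a \<in> lab (hd q)" by (auto simp: paths_def tp_def)
  qed
  finally show ?case .
next
  case (Box a)
  have a: "a \<in> \<Sigma>" using sub_closed(5) Box.prems by blast
  obtain w where w: "path p w" using Box.prems by (auto simp: paths_def)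
  have lp: "lab (hd p) = tp w" using real_lab[OF path_real[OF w]] .
  have "sat pframe pval p (Box a) \<longleftrightarrow> (\<forall>q\<in>paths. psim p q \<longrightarrow> a \<in> lab (hd q))"
    using S4I_model.sat_Box_iff[OF pframe_model, of p a] Box.prems Box.IH[OF a] by (auto simp del: sat.simps)
  also have "\<dots> \<longleftrightarrow> Box a \<in> lab (hd p)"
  proof
    assume "Box a \<in> lab (hd p)"
    then show "\<forall>q\<in>paths. psim p q \<longrightarrow> a \<in> lab (hd q)"
      using psim_hd paths_ne Box.prems sim_lab unfolding sensible_def by blast
  next
    assume *: "\<forall>q\<in>paths. psim p q \<longrightarrow> a \<in> lab (hd q)"
    show "Box a \<in> lab (hd p)"
    proof (rule ccontr)
      assume "Box a \<notin> lab (hd p)"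
      then have "\<not> sat F V w (Box a)" using Box.prems unfolding lp by (simp add: tp_def)
      then obtain v where v: "(w, v) \<in> mle F" "\<not> sat F V v a"
        using sat_Box_iff real_worlds[OF path_real[OF w]] by blast
      obtain q u where "path q u" "lab (hd q) = tp v" "psim p q"
        using psim_exists[OF w v(1), of "{}"] by auto
      with v * show False by (auto simp: paths_def tp_def)
    qed
  qed
  finally show ?case .
qed

end

text \<open>An equivalence at one world, so that falsifying and satisfying are covered
  together.\<close>

lemma finite_model:
  fixes F :: "'w frame"
  assumes "S4I_frame F" "valuation F V" "w \<in> worlds F"
  obtains G :: "nat frame" and n U i where "S4I_frame G" "worlds G = {..<n}" "valuation G U" "i \<in> worlds G"
    "sat G U i a \<longleftrightarrow> sat F V w a"
proof -
  interpret filtration F V a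
    by (intro filtration.intro S4I_model.intro assms(1,2))
  have "\<exists>t. real t w \<and> (\<forall>c\<in>{}. absorbs t c)"
    by (rule tree_exists[OF assms(3)]) simp_all
  then obtain t where t: "real t w" by (elim exE conjE)
  then have "path [t] w" by (rule path.single)
  then have p: "[t] \<in> paths" unfolding paths_def by blast
  have fin: "finite (worlds pframe)" using finite_paths by (simp add: paths_def)
  have pw: "[t] \<in> worlds pframe" using p by simp
  have sat: "sat pframe pval [t] a \<longleftrightarrow> sat F V w a"
    using truth[OF subforms_refl p] real_lab[OF t] by (simp add: tp_def)
  show ?thesis
  proof (rule transport_frame[OF pframe_S4I fin pval_valuation pw])
    fix H :: "nat frame" and U i
    assume H: "S4I_frame H" "worlds H = {..<card (worlds pframe)}" "valuation H U" "i \<in> worlds H"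
      and s: "\<And>b. sat H U i b \<longleftrightarrow> sat pframe pval [t] b"
    show ?thesis by (rule that[OF H]) (use s sat in simp)
  qed
qed

subsection \<open>A schematic calculus\<close>

text \<open>Schemes absorb the substitution rule, so that one derivation step can be checked from
  three parameters alone.\<close>

definition axm :: "fm \<Rightarrow> fm \<Rightarrow> fm \<Rightarrow> fm set" where
  "axm a b c = {Imp a (Imp b a), Imp (Imp a (Imp b c)) (Imp (Imp a b) (Imp a c)),
     Imp (And a b) a, Imp (And a b) b, Imp a (Imp b (And a b)),
     Imp a (Or a b), Imp b (Or a b), Imp (Imp a c) (Imp (Imp b c) (Imp (Or a b) c)), Imp Bot a,
     Imp (Box (Imp a b)) (Imp (Box a) (Box b)), Imp (Box (Imp a b)) (Imp (Dia a) (Dia b)),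
     Imp (Box a) a, Imp a (Dia a), Imp (Dia (Dia a)) (Dia a), Imp (Box a) (Box (Box a)),
     Imp (Dia (Or a b)) (Or (Dia a) (Dia b)), Neg (Dia Bot), Imp (Box (Or a b)) (Or (Box a) (Dia b))}"

inductive_set Ded :: "fm set" where
  ax: "x \<in> axm a b c \<Longrightarrow> x \<in> Ded"
| mp: "\<lbrakk>Imp a b \<in> Ded; a \<in> Ded\<rbrakk> \<Longrightarrow> b \<in> Ded"
| nec: "a \<in> Ded \<Longrightarrow> Box a \<in> Ded"

lemma axm_subst: "x \<in> axm a b c \<Longrightarrow> subst s x \<in> axm (subst s a) (subst s b) (subst s c)"
  by (auto simp: axm_def)

lemma Ded_subst: "x \<in> Ded \<Longrightarrow> subst s x \<in> Ded"
  by (induction rule: Ded.induct) (auto dest: axm_subst intro: Ded.intros)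

lemma Ded_ax:
  "Imp a (Imp b a) \<in> Ded" "Imp (Imp a (Imp b c)) (Imp (Imp a b) (Imp a c)) \<in> Ded"
  "Imp (And a b) a \<in> Ded" "Imp (And a b) b \<in> Ded" "Imp a (Imp b (And a b)) \<in> Ded"
  "Imp a (Or a b) \<in> Ded" "Imp b (Or a b) \<in> Ded"
  "Imp (Imp a c) (Imp (Imp b c) (Imp (Or a b) c)) \<in> Ded" "Imp Bot a \<in> Ded"
  "Imp (Box (Imp a b)) (Imp (Box a) (Box b)) \<in> Ded"
  "Imp (Box (Imp a b)) (Imp (Dia a) (Dia b)) \<in> Ded"
  "Imp (Box a) a \<in> Ded" "Imp a (Dia a) \<in> Ded" "Imp (Dia (Dia a)) (Dia a) \<in> Ded"
  "Imp (Box a) (Box (Box a)) \<in> Ded"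
  "Imp (Dia (Or a b)) (Or (Dia a) (Dia b)) \<in> Ded" "Neg (Dia Bot) \<in> Ded"
  "Imp (Box (Or a b)) (Or (Box a) (Dia b)) \<in> Ded"
  by (rule Ded.ax[of _ a b c], simp add: axm_def)+

lemma ipc_taut_Ded: "x \<in> ipc_taut \<Longrightarrow> x \<in> Ded"
  by (induction rule: ipc_taut.induct) (fact Ded_ax | erule (1) Ded.mp)+

lemma CS4_Ded: "x \<in> CS4 \<Longrightarrow> x \<in> Ded"
  by (induction rule: CS4.induct)
    (fact Ded_ax | erule ipc_taut_Ded | erule (1) Ded.mp | erule Ded.nec | erule Ded_subst)+

lemma S4I_Ded: "x \<in> S4I \<Longrightarrow> x \<in> Ded"
  by (induction rule: S4I.induct)
    (fact Ded_ax | erule CS4_Ded | erule (1) Ded.mp | erule Ded.nec | erule Ded_subst)+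

lemma axm_S4I: "x \<in> axm a b c \<Longrightarrow> x \<in> S4I"
proof -
  \<comment> \<open>The modal axioms are stated for two variables, which become \<open>a\<close> and
    \<open>b\<close>; \<open>c\<close> occurs only in the propositional schemes, which are already
    generic.\<close>
  let ?s = "\<lambda>n :: nat. if n = 0 then a else b"
  note cs = CS4.box_K[THEN CS4.subst[of _ ?s]] CS4.dia_K[THEN CS4.subst[of _ ?s]]
    CS4.box_T[THEN CS4.subst[of _ ?s]] CS4.dia_T[THEN CS4.subst[of _ ?s]]
    CS4.dia_4[THEN CS4.subst[of _ ?s]] CS4.box_4[THEN CS4.subst[of _ ?s]]
  note si = S4I.dia_disj[THEN S4I.subst[of _ ?s]] S4I.box_disj[THEN S4I.subst[of _ ?s]]
  assume "x \<in> axm a b c"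
  then have "x \<in> ipc_taut \<or> x \<in> CS4 \<or> x \<in> S4I"
    using cs si S4I.dia_bot unfolding axm_def
    by (auto intro: ipc_taut.intros)
  then show ?thesis by (blast intro: CS4.taut S4I.cs4)
qed

lemma S4I_eq_Ded: "S4I = Ded"
proof
  show "S4I \<subseteq> Ded" using S4I_Ded by blast
  have "x \<in> S4I" if "x \<in> Ded" for x
    using that by (induction rule: Ded.induct) (auto intro: axm_S4I S4I.mp S4I.nec)
  then show "Ded \<subseteq> S4I" by blast
qed

subsection \<open>Soundness\<close>

context S4I_model
begin

lemma sound_axm:
  assumes "x \<in> axm a b c" "w \<in> worlds F"
  shows "sat F V w x"
proof -
  have imp: "sat F V u (Imp p q)"
    if "\<And>v. v \<in> worlds F \<Longrightarrow> sat F V v p \<Longrightarrow> sat F V v q" for u p q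
    using that ile_worlds by auto
  have mp: "sat F V u q" if "sat F V u (Imp p q)" "sat F V u p" "u \<in> worlds F" for u p q
    using that by (rule sat_Imp_mp)
  have imp': "sat F V u (Imp q r)"
    if "sat F V u p" "\<And>v. v \<in> worlds F \<Longrightarrow> sat F V v p \<Longrightarrow> sat F V v q \<Longrightarrow> sat F V v r" for u p q r
    using that ile_worlds sat_mono by auto
  have imp2: "sat F V w (Imp p (Imp q r))"
    if "\<And>v. v \<in> worlds F \<Longrightarrow> sat F V v p \<Longrightarrow> sat F V v q \<Longrightarrow> sat F V v r" for p q r
  proof (rule imp)
    show "sat F V v (Imp q r)" if "sat F V v p" for v
      using that \<open>\<And>v. v \<in> worlds F \<Longrightarrow> sat F V v p \<Longrightarrow> sat F V v q \<Longrightarrow> sat F V v r\<close>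
      by (rule imp')
  qed
  have box: "sat F V u (Box p) \<longleftrightarrow> (\<forall>v. (u, v) \<in> mle F \<longrightarrow> sat F V v p)"
    and dia: "sat F V u (Dia p) \<longleftrightarrow> (\<exists>v. (u, v) \<in> mle F \<and> sat F V v p)" if "u \<in> worlds F" for u p
    using sat_Box_iff sat_Dia_iff that by blast+
  have 1: "sat F V w (Imp a (Imp b a))" by (rule imp2)
  have 2: "sat F V w (Imp (Imp a (Imp b c)) (Imp (Imp a b) (Imp a c)))"
  proof (rule imp2)
    fix v assume v: "v \<in> worlds F" "sat F V v (Imp a (Imp b c))" "sat F V v (Imp a b)"
    \<comment> \<open>\<open>imp'\<close> carries a single hypothesis to later worlds, so both are
      packed into a conjunction.\<close>
    then have "sat F V v (And (Imp a (Imp b c)) (Imp a b))" by simp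
    then show "sat F V v (Imp a c)"
    proof (rule imp')
      fix u assume "u \<in> worlds F" "sat F V u (And (Imp a (Imp b c)) (Imp a b))" "sat F V u a"
      then show "sat F V u c" by (metis mp sat.simps(3))
    qed
  qed
  have 3: "sat F V w (Imp (And a b) a)" "sat F V w (Imp (And a b) b)"
    "sat F V w (Imp a (Or a b))" "sat F V w (Imp b (Or a b))" "sat F V w (Imp Bot a)"
    by (rule imp, simp)+
  have 4: "sat F V w (Imp a (Imp b (And a b)))" by (rule imp2) simp
  have 5: "sat F V w (Imp (Imp a c) (Imp (Imp b c) (Imp (Or a b) c)))"
  proof (rule imp2)
    fix v assume v: "v \<in> worlds F" "sat F V v (Imp a c)" "sat F V v (Imp b c)"
    then have "sat F V v (And (Imp a c) (Imp b c))" by simp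
    then show "sat F V v (Imp (Or a b) c)"
    proof (rule imp')
      fix u assume "u \<in> worlds F" "sat F V u (And (Imp a c) (Imp b c))" "sat F V u (Or a b)"
      then show "sat F V u c" by (metis mp sat.simps(3,4))
    qed
  qed
  have 6: "sat F V w (Imp (Box (Imp a b)) (Imp (Box a) (Box b)))"
    by (rule imp2) (meson box mp mle_worlds)
  have 7: "sat F V w (Imp (Box (Imp a b)) (Imp (Dia a) (Dia b)))"
    by (rule imp2) (meson box dia mp mle_worlds)
  have 8: "sat F V w (Imp (Box a) a)" by (rule imp) (meson box mle_refl)
  have 9: "sat F V w (Imp a (Dia a))" by (rule imp) (meson dia mle_refl)
  have 10: "sat F V w (Imp (Dia (Dia a)) (Dia a))"
    by (rule imp) (meson dia mle_trans mle_worlds)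
  have 11: "sat F V w (Imp (Box a) (Box (Box a)))"
    by (rule imp) (meson box mle_trans mle_worlds)
  have 12: "sat F V w (Imp (Dia (Or a b)) (Or (Dia a) (Dia b)))"
    by (rule imp) (auto simp: dia simp del: sat.simps(6))
  have 13: "sat F V w (Neg (Dia Bot))"
    by (rule imp) (auto simp: dia simp del: sat.simps(6))
  have 14: "sat F V w (Imp (Box (Or a b)) (Or (Box a) (Dia b)))"
    by (rule imp) (auto simp: box dia simp del: sat.simps(6,7))
  from assms(1) show ?thesis
    unfolding axm_def
    using 1 2 3 4 5 6 7 8 9 10 11 12 13 14 by (elim insertE emptyE) (simp_all only:)
qed

lemma sound: "x \<in> Ded \<Longrightarrow> w \<in> worlds F \<Longrightarrow> sat F V w x"
proof (induction arbitrary: w rule: Ded.induct)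
  case (ax x a b c)
  then show ?case by (rule sound_axm)
next
  case (mp a b)
  then show ?case using sat_Imp_mp by blast
next
  case (nec a)
  then show ?case using sat_Box_iff mle_worlds by blast
qed

end

subsection \<open>Theories\<close>

text \<open>No closure under necessitation: a theory collects what holds at one world, and only
  theorems may be boxed.\<close>

definition thy :: "fm set \<Rightarrow> bool" where
  "thy T \<longleftrightarrow> Ded \<subseteq> T \<and> (\<forall>a b. Imp a b \<in> T \<longrightarrow> a \<in> T \<longrightarrow> b \<in> T)"

definition prime :: "fm set \<Rightarrow> bool" where
  "prime T \<longleftrightarrow> thy T \<and> Bot \<notin> T \<and> (\<forall>a b. Or a b \<in> T \<longrightarrow> a \<in> T \<or> b \<in> T)"

text \<open>For a theory \<open>T\<close> this is the least theory containing \<open>T\<close> and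
  \<open>a\<close>.\<close>

definition ext :: "fm set \<Rightarrow> fm \<Rightarrow> fm set" where
  "ext T a = {b. Imp a b \<in> T}"

lemma thy_Ded [simp]: "thy Ded"
  using Ded.mp by (auto simp: thy_def)

lemma thy_mp: "thy T \<Longrightarrow> Imp a b \<in> T \<Longrightarrow> a \<in> T \<Longrightarrow> b \<in> T"
  by (auto simp: thy_def)

lemma thy_ax: "thy T \<Longrightarrow> a \<in> Ded \<Longrightarrow> a \<in> T"
  by (auto simp: thy_def)

lemma thy_step: "thy T \<Longrightarrow> Imp a b \<in> Ded \<Longrightarrow> a \<in> T \<Longrightarrow> b \<in> T"
  using thy_mp thy_ax by blast

lemma thy_K: "thy T \<Longrightarrow> b \<in> T \<Longrightarrow> Imp a b \<in> T"
  using thy_step[OF _ Ded_ax(1)] by blast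

lemma thy_ext:
  assumes "thy T"
  shows "thy (ext T a)"
  unfolding thy_def ext_def
proof (intro conjI allI impI subsetI; clarify)
  show "Imp a b \<in> T" if "b \<in> Ded" for b using that thy_K[OF assms] thy_ax[OF assms] by blast
  show "Imp a c \<in> T" if "Imp a (Imp b c) \<in> T" "Imp a b \<in> T" for b c
    using that thy_step[OF assms Ded_ax(2)] thy_mp[OF assms] by blast
qed

lemma ext_mono: "thy T \<Longrightarrow> b \<in> T \<Longrightarrow> b \<in> ext T a"
  using thy_K by (simp add: ext_def)

lemma ext_self: "thy T \<Longrightarrow> a \<in> ext T a"
  unfolding ext_def mem_Collect_eq
  by (rule thy_mp[OF _ thy_mp[OF _ thy_ax[OF _ Ded_ax(2)] thy_ax[OF _ Ded_ax(1)]] thy_ax[OF _ Ded_ax(1)]])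

text \<open>The deduction theorem as an introduction rule, with \<open>ext T a\<close> as the
  instance of \<open>S\<close>. It replaces Hilbert derivations by arguments about membership in
  theories.\<close>

lemma thy_impI:
  assumes "thy T" "\<And>S. thy S \<Longrightarrow> T \<subseteq> S \<Longrightarrow> a \<in> S \<Longrightarrow> b \<in> S"
  shows "Imp a b \<in> T"
proof -
  have "b \<in> ext T a"
    by (intro assms(2) thy_ext subsetI ext_mono ext_self assms(1))
  then show ?thesis by (simp add: ext_def)
qed

lemma thy_And:
  assumes "thy T"
  shows "And a b \<in> T \<longleftrightarrow> a \<in> T \<and> b \<in> T"
  using thy_step[OF assms Ded_ax(3), of a b] thy_step[OF assms Ded_ax(4), of a b]
    thy_mp[OF assms thy_step[OF assms Ded_ax(5), of a b]] by blast

lemma thy_OrI: "thy T \<Longrightarrow> a \<in> T \<or> b \<in> T \<Longrightarrow> Or a b \<in> T"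
  by (metis thy_step Ded_ax(6,7))

lemma thy_OrE:
  assumes "thy T" "Or a b \<in> T" "Imp a c \<in> T" "Imp b c \<in> T"
  shows "c \<in> T"
  by (rule thy_mp[OF assms(1) thy_mp[OF assms(1) thy_step[OF assms(1) Ded_ax(8)]]]) (fact assms)+

lemma Imp_refl: "Imp a a \<in> Ded"
  by (rule thy_impI) simp_all

lemma Imp_trans: "Imp a b \<in> Ded \<Longrightarrow> Imp b c \<in> Ded \<Longrightarrow> Imp a c \<in> Ded"
  by (rule thy_impI) (simp, metis thy_step)

lemma Imp_Or: "Imp a c \<in> Ded \<Longrightarrow> Imp b c \<in> Ded \<Longrightarrow> Imp (Or a b) c \<in> Ded"
  by (rule thy_impI) (simp, metis thy_OrE thy_ax)

lemma box_mp: "thy T \<Longrightarrow> Box (Imp a b) \<in> T \<Longrightarrow> Box a \<in> T \<Longrightarrow> Box b \<in> T"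
  by (rule thy_mp[OF _ thy_step[OF _ Ded_ax(10)]])

lemma box_mono: "thy T \<Longrightarrow> Imp a b \<in> Ded \<Longrightarrow> Box a \<in> T \<Longrightarrow> Box b \<in> T"
  by (rule box_mp[OF _ thy_ax[OF _ Ded.nec]])

lemma dia_mp: "thy T \<Longrightarrow> Box (Imp a b) \<in> T \<Longrightarrow> Dia a \<in> T \<Longrightarrow> Dia b \<in> T"
  by (rule thy_mp[OF _ thy_step[OF _ Ded_ax(11)]])

text \<open>A directed set generates an ideal of the Lindenbaum algebra, and a theory that avoids
  the generators avoids the ideal. Singletons qualify without closure under disjunction.\<close>

definition directed :: "fm set \<Rightarrow> bool" where
  "directed E \<longleftrightarrow> E \<noteq> {} \<and> (\<forall>x\<in>E. \<forall>y\<in>E. \<exists>z\<in>E. Imp x z \<in> Ded \<and> Imp y z \<in> Ded)"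

lemma directed_nonempty: "directed E \<Longrightarrow> \<exists>x. x \<in> E"
  by (auto simp: directed_def)

lemma directedD: "directed E \<Longrightarrow> x \<in> E \<Longrightarrow> y \<in> E \<Longrightarrow> \<exists>z\<in>E. Imp x z \<in> Ded \<and> Imp y z \<in> Ded"
  unfolding directed_def by (elim conjE) blast

lemma directed_singleton: "directed {a}"
  by (auto simp: directed_def Imp_refl)

text \<open>The prime filter theorem. In a theory maximal among those that contain \<open>D\<close>
  and avoid \<open>E\<close>, every missing formula implies a member of \<open>E\<close>;
  directedness joins the members found for \<open>a\<close> and \<open>b\<close>, which gives
  primeness.\<close>

lemma prime_extension:
  assumes "thy D" "directed E" "D \<inter> E = {}"
  shows "\<exists>T. prime T \<and> D \<subseteq> T \<and> T \<inter> E = {}"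
proof -
  let ?A = "{T. thy T \<and> D \<subseteq> T \<and> T \<inter> E = {}}"
  have "\<exists>M\<in>?A. \<forall>X\<in>?A. M \<subseteq> X \<longrightarrow> X = M"
  proof (rule subset_Zorn_nonempty)
    show "?A \<noteq> {}" using assms by blast
    fix C assume C: "C \<noteq> {}" "subset.chain ?A C"
    then have el: "\<And>T. T \<in> C \<Longrightarrow> thy T \<and> D \<subseteq> T \<and> T \<inter> E = {}" by (auto simp: subset_chain_def)
    have "thy (\<Union>C)"
      unfolding thy_def
    proof (intro conjI allI impI)
      show "Ded \<subseteq> \<Union>C" using C(1) el unfolding thy_def by blast
      fix a b assume "Imp a b \<in> \<Union>C" "a \<in> \<Union>C"
      then obtain S T where ST: "S \<in> C" "T \<in> C" "Imp a b \<in> S" "a \<in> T" by blast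
      then have "S \<subseteq> T \<or> T \<subseteq> S" using C(2) by (auto simp: subset_chain_def)
      then show "b \<in> \<Union>C" using ST thy_mp el by blast
    qed
    then show "\<Union>C \<in> ?A" using el C(1) by blast
  qed
  then obtain M where M: "thy M" "D \<subseteq> M" "M \<inter> E = {}"
    and "\<forall>X\<in>?A. M \<subseteq> X \<longrightarrow> X = M" by auto
  then have max: "X = M" if "thy X" "X \<inter> E = {}" "M \<subseteq> X" for X
    using that by (simp add: order_trans[of D M X])
  have meet: "\<exists>e\<in>E. Imp a e \<in> M" if "a \<notin> M" for a
  proof (rule ccontr)
    assume "\<not> ?thesis"
    then have "ext M a \<inter> E = {}" by (auto simp: ext_def)
    then have "ext M a = M" using max thy_ext[OF M(1)] ext_mono[OF M(1)] by blast
    with ext_self[OF M(1)] that show False by blast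
  qed
  have "Bot \<notin> M"
  proof
    assume "Bot \<in> M"
    then have "e \<in> M" for e using thy_step[OF M(1) Ded_ax(9)] by blast
    with M(3) assms(2) show False by (auto simp: directed_def)
  qed
  moreover have "a \<in> M \<or> b \<in> M" if ab: "Or a b \<in> M" for a b
  proof (rule ccontr)
    assume "\<not> ?thesis"
    then obtain e1 e2 where e: "e1 \<in> E" "Imp a e1 \<in> M" "e2 \<in> E" "Imp b e2 \<in> M" using meet by blast
    then obtain z where z: "z \<in> E" "Imp e1 z \<in> Ded" "Imp e2 z \<in> Ded"
      using assms(2) by (auto simp: directed_def)
    have "Imp a z \<in> M"
      by (rule thy_impI[OF M(1)]) (meson e(2) subsetD thy_mp thy_step z(2))
    moreover have "Imp b z \<in> M"
      by (rule thy_impI[OF M(1)]) (meson e(4) subsetD thy_mp thy_step z(3))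
    ultimately have "z \<in> M" using thy_OrE[OF M(1) ab] by blast
    with z(1) M(3) show False by blast
  qed
  ultimately show ?thesis using M by (auto simp: prime_def)
qed

subsection \<open>The canonical model\<close>

text \<open>Intuitionistically neither modality defines the other, so each contributes a
  condition.\<close>

definition crel :: "fm set \<Rightarrow> fm set \<Rightarrow> bool" where
  "crel G H \<longleftrightarrow> (\<forall>a. Box a \<in> G \<longrightarrow> a \<in> H) \<and> (\<forall>a\<in>H. Dia a \<in> G)"

lemma primeD: "prime T \<Longrightarrow> thy T" "prime T \<Longrightarrow> Bot \<notin> T" "prime T \<Longrightarrow> Or a b \<in> T \<Longrightarrow> a \<in> T \<or> b \<in> T"
  by (auto simp: prime_def)

lemma crel_refl: "thy G \<Longrightarrow> crel G G"
  using thy_step[OF _ Ded_ax(12)] thy_step[OF _ Ded_ax(13)] by (auto simp: crel_def)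

lemma crel_trans: "thy G \<Longrightarrow> crel G H \<Longrightarrow> crel H K \<Longrightarrow> crel G K"
  using thy_step[OF _ Ded_ax(14), of G] thy_step[OF _ Ded_ax(15), of G] by (auto simp: crel_def)

text \<open>The axiom \<open>Neg (Dia Bot)\<close> makes the set nonempty, and distribution of
  diamonds over disjunctions provides upper bounds.\<close>

lemma Dia_complement_directed:
  assumes "prime G"
  shows "directed {e. Dia e \<notin> G}"
  unfolding directed_def
proof (intro conjI ballI)
  note G = primeD[OF assms]
  have "Dia Bot \<notin> G" using G(2) thy_step[OF G(1) Ded_ax(17)] by blast
  then show "{e. Dia e \<notin> G} \<noteq> {}" by blast
  fix x y assume "x \<in> {e. Dia e \<notin> G}" "y \<in> {e. Dia e \<notin> G}"
  then have "Dia (Or x y) \<notin> G" using G(3) thy_step[OF G(1) Ded_ax(16)] by blast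
  then show "\<exists>z\<in>{e. Dia e \<notin> G}. Imp x z \<in> Ded \<and> Imp y z \<in> Ded" using Ded_ax(6,7) by blast
qed

text \<open>Stated for a set \<open>A\<close> to serve twice: a singleton gives the truth lemma for
  diamonds, and a full theory gives upward confluence of the canonical frame.\<close>

lemma Dia_successor:
  assumes G: "prime G" and ne: "A \<noteq> {}" and dia: "\<And>d. d \<in> A \<Longrightarrow> Dia d \<in> G"
    and dir: "\<And>x y. x \<in> A \<Longrightarrow> y \<in> A \<Longrightarrow> \<exists>z\<in>A. Imp z x \<in> Ded \<and> Imp z y \<in> Ded"
  shows "\<exists>H. prime H \<and> A \<subseteq> H \<and> crel G H"
proof -
  note t = primeD(1)[OF G]
  \<comment> \<open>The theory generated by \<open>A\<close> and the formulas whose box is in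
    \<open>G\<close>; downward directedness lets one \<open>d\<close> stand for finitely many
    members of \<open>A\<close>.\<close>
  let ?D = "{x. \<exists>d\<in>A. Box (Imp d x) \<in> G}"
  have bx: "Box x \<in> G" if "x \<in> Ded" for x using that t thy_ax Ded.nec by blast
  have D: "thy ?D"
    unfolding thy_def
  proof (intro conjI allI impI subsetI)
    fix x assume "x \<in> Ded"
    then have "Imp d x \<in> Ded" for d using thy_K by simp
    with bx ne show "x \<in> ?D" by blast
  next
    fix x y assume "Imp x y \<in> ?D" "x \<in> ?D"
    then obtain d1 d2 where d: "d1 \<in> A" "d2 \<in> A" "Box (Imp d1 (Imp x y)) \<in> G" "Box (Imp d2 x) \<in> G"
      by blast
    then obtain z where z: "z \<in> A" "Imp z d1 \<in> Ded" "Imp z d2 \<in> Ded" using dir by blast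
    have "Imp (Imp d1 (Imp x y)) (Imp (Imp d2 x) (Imp z y)) \<in> Ded"
    proof (rule thy_impI[OF thy_Ded], rule thy_impI, assumption, rule thy_impI, assumption)
      fix S1 S2 S3 assume S: "thy S3" "S1 \<subseteq> S2" "S2 \<subseteq> S3" "Imp d1 (Imp x y) \<in> S1" "Imp d2 x \<in> S2" "z \<in> S3"
      then have "d1 \<in> S3" "d2 \<in> S3" using z thy_step by blast+
      with S show "y \<in> S3" using thy_mp by blast
    qed
    with d have "Box (Imp z y) \<in> G" using bx box_mp[OF t] by blast
    with z(1) show "y \<in> ?D" by blast
  qed
  have "?D \<inter> {e. Dia e \<notin> G} = {}" using dia dia_mp[OF t] by blast
  from prime_extension[OF D Dia_complement_directed[OF G] this] obtain H where
    H: "prime H" "?D \<subseteq> H" "H \<inter> {e. Dia e \<notin> G} = {}" by blast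
  have "A \<subseteq> ?D" using bx Imp_refl by blast
  moreover have "x \<in> ?D" if "Box x \<in> G" for x
    using ne that box_mono[OF t Ded_ax(1)] by blast
  ultimately have "A \<subseteq> H" "crel G H" using H(2,3) unfolding crel_def by blast+
  with H(1) show ?thesis by blast
qed

text \<open>Dual to \<open>Dia_successor\<close>: \<open>E\<close> is a singleton in the truth lemma
  for boxes and the complement of a prime theory in downward confluence. The axiom leading from
  \<open>Box (Or f e)\<close> to \<open>Or (Box f) (Dia e)\<close> allows a successor to avoid
  \<open>E\<close> together with every \<open>e\<close> such that \<open>Dia e\<close> is not in
  \<open>G\<close>.\<close>

lemma Box_successor:
  assumes G: "prime G" and E: "directed E" and box: "\<And>e. e \<in> E \<Longrightarrow> Box e \<notin> G"
  shows "\<exists>H. prime H \<and> H \<inter> E = {} \<and> crel G H"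
proof -
  note t = primeD(1)[OF G]
  let ?D = "{x. Box x \<in> G}"
  let ?N = "{e. Dia e \<notin> G}"
  \<comment> \<open>The ideal generated by \<open>?N\<close> and \<open>E\<close>; one member of
    each suffices because both are directed.\<close>
  let ?E = "{x. \<exists>e\<in>?N. \<exists>f\<in>E. Imp x (Or e f) \<in> Ded}"
  have N: "directed ?N" by (rule Dia_complement_directed[OF G])
  have D: "thy ?D"
    unfolding thy_def
  proof (intro conjI subsetI allI impI CollectI)
    show "Box x \<in> G" if "x \<in> Ded" for x using thy_ax[OF t Ded.nec[OF that]] .
    show "Box y \<in> G" if "Imp x y \<in> ?D" "x \<in> ?D" for x y
      using box_mp[OF t, of x y] that by simp
  qed
  obtain e0 f0 where ef0: "e0 \<in> ?N" "f0 \<in> E"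
    using directed_nonempty[OF N] directed_nonempty[OF E] by fast
  have sub: "x \<in> ?E" if "x \<in> E \<or> x \<in> ?N" for x
    using that
  proof
    assume "x \<in> E"
    with ef0(1) Ded_ax(7) show ?thesis by blast
  next
    assume "x \<in> ?N"
    with ef0(2) Ded_ax(6) show ?thesis by blast
  qed
  have E': "directed ?E"
    unfolding directed_def
  proof (intro conjI ballI)
    show "?E \<noteq> {}" using sub[of f0] ef0(2) by blast
    fix x y assume "x \<in> ?E" "y \<in> ?E"
    then obtain e1 f1 e2 f2 where 1: "e1 \<in> ?N" "f1 \<in> E" "Imp x (Or e1 f1) \<in> Ded"
      and 2: "e2 \<in> ?N" "f2 \<in> E" "Imp y (Or e2 f2) \<in> Ded" by blast
    obtain e where e: "e \<in> ?N" "Imp e1 e \<in> Ded" "Imp e2 e \<in> Ded"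
      using directedD[OF N 1(1) 2(1)] by blast
    obtain f where f: "f \<in> E" "Imp f1 f \<in> Ded" "Imp f2 f \<in> Ded"
      using directedD[OF E 1(2) 2(2)] by blast
    have "Imp (Or e1 f1) (Or e f) \<in> Ded" "Imp (Or e2 f2) (Or e f) \<in> Ded"
      using e f by (auto intro!: Imp_Or intro: Imp_trans Ded_ax(6,7))
    then have "Imp x (Or e f) \<in> Ded" "Imp y (Or e f) \<in> Ded" using 1(3) 2(3) Imp_trans by metis+
    moreover have "Or e f \<in> ?E" using e(1) f(1) Imp_refl by blast
    ultimately show "\<exists>z\<in>?E. Imp x z \<in> Ded \<and> Imp y z \<in> Ded" by (rule_tac bexI[of _ "Or e f"]) simp_all
  qed
  have "Box x \<notin> G" if x: "e \<in> ?N" "f \<in> E" "Imp x (Or e f) \<in> Ded" for x e f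
  proof
    assume "Box x \<in> G"
    moreover have "Imp x (Or f e) \<in> Ded"
      by (rule Imp_trans[OF x(3)]) (intro Imp_Or Ded_ax)
    ultimately have "Box (Or f e) \<in> G" using box_mono t by blast
    then have "Or (Box f) (Dia e) \<in> G" using thy_step[OF t Ded_ax(18)] by blast
    with x box primeD(3)[OF G] show False by blast
  qed
  then have "?D \<inter> ?E = {}" by blast
  from prime_extension[OF D E' this] obtain H where H: "prime H" "?D \<subseteq> H" "H \<inter> ?E = {}" by blast
  have "E \<subseteq> ?E" "?N \<subseteq> ?E" using sub by blast+
  with H(2,3) have "H \<inter> E = {}" "crel G H" unfolding crel_def by blast+
  with H(1) show ?thesis by blast
qed

definition cframe :: "fm set frame" where
  "cframe = \<lparr>worlds = {T. prime T}, fallible = {}, ile = {(S, T). prime S \<and> prime T \<and> S \<subseteq> T},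
     mle = {(S, T). prime S \<and> prime T \<and> crel S T}\<rparr>"

definition cval :: "nat \<Rightarrow> fm set set" where
  "cval n = {T. prime T \<and> Var n \<in> T}"

lemma cframe_simps [simp]:
  "worlds cframe = {T. prime T}" "fallible cframe = {}"
  "(S, T) \<in> ile cframe \<longleftrightarrow> prime S \<and> prime T \<and> S \<subseteq> T"
  "(S, T) \<in> mle cframe \<longleftrightarrow> prime S \<and> prime T \<and> crel S T"
  by (auto simp: cframe_def)

lemma cframe_S4I: "S4I_frame cframe"
proof -
  have "preorder_on (worlds cframe) (ile cframe)"
    unfolding preorder_on_def refl_on_def trans_on_def by auto
  moreover have "preorder_on (worlds cframe) (mle cframe)"
    unfolding preorder_on_def refl_on_def trans_on_def
  proof (intro conjI ballI impI)
    show "mle cframe \<subseteq> worlds cframe \<times> worlds cframe" by auto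
    show "(G, G) \<in> mle cframe" if "G \<in> worlds cframe" for G
      using that crel_refl[OF primeD(1), of G] by simp
    show "(G, K) \<in> mle cframe" if "(G, H) \<in> mle cframe" "(H, K) \<in> mle cframe" for G H K
      using that crel_trans[OF primeD(1), of G H K] by simp
  qed
  moreover have "forth_up cframe"
    unfolding forth_up_def
  proof (intro allI impI)
    fix G G' H assume *: "(G, G') \<in> ile cframe" "(G, H) \<in> mle cframe"
    then have H: "thy H" "crel G H" "G \<subseteq> G'" "prime G'" using primeD(1)[of H] by simp_all
    \<comment> \<open>Members of \<open>H\<close> have their diamonds in \<open>G\<close> and thus
      in \<open>G'\<close>, so all of \<open>H\<close> fits into a successor of
      \<open>G'\<close>.\<close>
    have "\<exists>H'. prime H' \<and> H \<subseteq> H' \<and> crel G' H'"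
    proof (rule Dia_successor[OF H(4)])
      show "H \<noteq> {}" using thy_ax[OF H(1) Imp_refl] by blast
      show "Dia d \<in> G'" if "d \<in> H" for d using that H by (auto simp: crel_def)
      fix x y assume "x \<in> H" "y \<in> H"
      then have "And x y \<in> H" using thy_And H(1) by blast
      then show "\<exists>z\<in>H. Imp z x \<in> Ded \<and> Imp z y \<in> Ded" using Ded_ax(3,4) by blast
    qed
    with * show "\<exists>H'. (H, H') \<in> ile cframe \<and> (G', H') \<in> mle cframe" by auto
  qed
  moreover have "forth_down cframe"
    unfolding forth_down_def
  proof (intro allI impI)
    fix G H H' assume *: "(G, H) \<in> ile cframe" "(H, H') \<in> mle cframe"
    then have G: "prime G" "crel H H'" "G \<subseteq> H" "prime H'" by auto
    \<comment> \<open>A successor inside \<open>H'\<close> is one that avoids the complement of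
      \<open>H'\<close>.\<close>
    have "\<exists>G'. prime G' \<and> G' \<inter> (- H') = {} \<and> crel G G'"
    proof (rule Box_successor[OF G(1)])
      show "directed (- H')"
        unfolding directed_def
      proof (intro conjI ballI)
        show "- H' \<noteq> {}" using primeD(2)[OF G(4)] by blast
        fix x y assume "x \<in> - H'" "y \<in> - H'"
        then have "Or x y \<in> - H'" using primeD(3)[OF G(4)] by blast
        then show "\<exists>z\<in>- H'. Imp x z \<in> Ded \<and> Imp y z \<in> Ded" using Ded_ax(6,7) by blast
      qed
      show "Box e \<notin> G" if "e \<in> - H'" for e using that G by (auto simp: crel_def)
    qed
    with * show "\<exists>G'. (G, G') \<in> mle cframe \<and> (G', H') \<in> ile cframe" by auto
  qed
  ultimately show ?thesis
    by (simp add: S4I_frame_def bi_frame_def infallible_def up_closed_def)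
qed

lemma cval_valuation: "valuation cframe cval"
  by (auto simp: valuation_def up_closed_def cval_def)

lemmas cframe_model = S4I_model.intro[OF cframe_S4I cval_valuation]

lemma canonical_truth: "prime T \<Longrightarrow> sat cframe cval T a \<longleftrightarrow> a \<in> T"
proof (induction a arbitrary: T)
  case (Var n)
  then show ?case by (simp add: cval_def)
next
  case Bot
  then show ?case using primeD(2) by simp
next
  case (And a b)
  then show ?case using thy_And[OF primeD(1)] by simp
next
  case (Or a b)
  then show ?case using thy_OrI[OF primeD(1)] primeD(3) by simp blast
next
  case (Imp a b)
  note t = primeD(1)[OF Imp.prems]
  have "sat cframe cval T (Imp a b) \<longleftrightarrow> (\<forall>S. prime S \<longrightarrow> T \<subseteq> S \<longrightarrow> a \<in> S \<longrightarrow> b \<in> S)"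
    using Imp by auto
  also have "\<dots> \<longleftrightarrow> Imp a b \<in> T"
  proof
    assume "Imp a b \<in> T"
    then show "\<forall>S. prime S \<longrightarrow> T \<subseteq> S \<longrightarrow> a \<in> S \<longrightarrow> b \<in> S" using thy_mp primeD(1) by blast
  next
    assume *: "\<forall>S. prime S \<longrightarrow> T \<subseteq> S \<longrightarrow> a \<in> S \<longrightarrow> b \<in> S"
    show "Imp a b \<in> T"
    proof (rule ccontr)
      assume "Imp a b \<notin> T"
      then have "ext T a \<inter> {b} = {}" by (simp add: ext_def)
      from prime_extension[OF thy_ext[OF t] directed_singleton this] obtain S where
        "prime S" "ext T a \<subseteq> S" "b \<notin> S" by blast
      with * ext_self[OF t] ext_mono[OF t] show False by blast
    qed
  qed
  finally show ?case .
next
  case (Dia a)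
  have "sat cframe cval T (Dia a) \<longleftrightarrow> (\<exists>S. prime S \<and> crel T S \<and> a \<in> S)"
    using S4I_model.sat_Dia_iff[OF cframe_model, of T a] Dia by (auto simp del: sat.simps)
  also have "\<dots> \<longleftrightarrow> Dia a \<in> T"
  proof
    assume "Dia a \<in> T"
    then have "\<exists>S. prime S \<and> {a} \<subseteq> S \<and> crel T S"
      using Imp_refl by (intro Dia_successor[OF Dia.prems]) auto
    then show "\<exists>S. prime S \<and> crel T S \<and> a \<in> S" by auto
  qed (auto simp: crel_def)
  finally show ?case .
next
  case (Box a)
  have "sat cframe cval T (Box a) \<longleftrightarrow> (\<forall>S. prime S \<longrightarrow> crel T S \<longrightarrow> a \<in> S)"
    using S4I_model.sat_Box_iff[OF cframe_model, of T a] Box by (auto simp del: sat.simps)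
  also have "\<dots> \<longleftrightarrow> Box a \<in> T"
  proof
    assume *: "\<forall>S. prime S \<longrightarrow> crel T S \<longrightarrow> a \<in> S"
    show "Box a \<in> T"
    proof (rule ccontr)
      assume "Box a \<notin> T"
      then have "\<exists>S. prime S \<and> S \<inter> {a} = {} \<and> crel T S"
        by (intro Box_successor[OF Box.prems directed_singleton]) auto
      with * show False by auto
    qed
  qed (auto simp: crel_def)
  finally show ?case .
qed

lemma finite_completeness:
  assumes "a \<notin> Ded"
  obtains G :: "nat frame" and n U i where "S4I_frame G" "worlds G = {..<n}" "valuation G U" "i < n"
    "\<not> sat G U i a"
proof -
  obtain T where T: "prime T" "a \<notin> T"
    using prime_extension[OF thy_Ded directed_singleton[of a]] assms by blast
  then have Tw: "T \<in> worlds cframe" by simp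
  show ?thesis
    by (rule finite_model[OF cframe_S4I cval_valuation Tw, of a])
      (use that T canonical_truth in auto)
qed

subsection \<open>Total recursive functions\<close>

text \<open>Arguments are given by an environment, of which only the first \<open>k\<close> values are used; a bound
  variable is a new argument \<open>0\<close> that shifts the others, so that closure properties apply as
  introduction rules by higher-order unification.\<close>

definition computable :: "nat \<Rightarrow> ((nat \<Rightarrow> nat) \<Rightarrow> nat) \<Rightarrow> bool" where
  "computable k f \<longleftrightarrow> (\<exists>c. \<forall>e. rec_eval c (map e [0..<k]) (f e))"

definition decidable :: "nat \<Rightarrow> ((nat \<Rightarrow> nat) \<Rightarrow> bool) \<Rightarrow> bool" where
  "decidable k P \<longleftrightarrow> computable k (\<lambda>e. of_bool (P e))"

lemma map_env_Suc: "map e [0..<Suc k] = e 0 # map (\<lambda>i. e (Suc i)) [0..<k]"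
  by (simp add: upt_conv_Cons map_Suc_upt[symmetric] del: upt_Suc)

lemma computable_var: "i < k \<Longrightarrow> computable k (\<lambda>e. e i)"
  unfolding computable_def
proof (intro exI[of _ "Proj i"] allI)
  show "rec_eval (Proj i) (map e [0..<k]) (e i)" if "i < k" for e
    using rec_eval.proj[of i "map e [0..<k]"] that by simp
qed

lemma computable_comp:
  assumes f: "computable (length gs) f" and gs: "\<And>g. g \<in> set gs \<Longrightarrow> computable k g"
  shows "computable k (\<lambda>e. f (\<lambda>i. (gs ! i) e))"
proof -
  obtain c where c: "\<And>e. rec_eval c (map e [0..<length gs]) (f e)"
    using f by (auto simp: computable_def)
  obtain C where C: "\<And>g e. g \<in> set gs \<Longrightarrow> rec_eval (C g) (map e [0..<k]) (g e)"
    using gs unfolding computable_def by metis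
  have "rec_eval (Comp c (map C gs)) (map e [0..<k]) (f (\<lambda>i. (gs ! i) e))" for e
  proof (rule rec_eval.comp)
    show "list_all2 (\<lambda>g y. rec_eval g (map e [0..<k]) y) (map C gs) (map (\<lambda>i. (gs ! i) e) [0..<length gs])"
      using C by (simp add: list_all2_conv_all_nth)
  qed (rule c)
  then show ?thesis unfolding computable_def by blast
qed

lemma computable_comp1:
  assumes "computable 1 (\<lambda>e. F (e 0))" "computable k g"
  shows "computable k (\<lambda>e. F (g e))"
  using computable_comp[of "[g]" "\<lambda>e. F (e 0)" k] assms by simp

lemma computable_comp2:
  assumes "computable 2 (\<lambda>e. F (e 0) (e 1))" "computable k g" "computable k h"
  shows "computable k (\<lambda>e. F (g e) (h e))"
  using computable_comp[of "[g, h]" "\<lambda>e. F (e 0) (e 1)" k] assms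
  by (auto simp: numeral_2_eq_2)

lemma computable_Suc: "computable k f \<Longrightarrow> computable k (\<lambda>e. Suc (f e))"
proof (rule computable_comp1[of Suc])
  show "computable 1 (\<lambda>e. Suc (e 0))"
    unfolding computable_def by (intro exI[of _ Succ]) (simp add: rec_eval.succ)
qed

lemma computable_const: "computable k (\<lambda>e. n)"
proof (induction n)
  case 0
  show ?case unfolding computable_def using rec_eval.zero by blast
qed (rule computable_Suc)

lemma computable_rec:
  assumes a: "computable k a" and h: "computable (Suc (Suc k)) (\<lambda>e. h (e 0) (e 1) (\<lambda>i. e (Suc (Suc i))))"
    and n: "computable k n"
  shows "computable k (\<lambda>e. rec_nat (a e) (\<lambda>m y. h m y e) (n e))"
proof -
  obtain ca where ca: "\<And>e. rec_eval ca (map e [0..<k]) (a e)" using a by (auto simp: computable_def)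
  obtain ch where ch: "\<And>e. rec_eval ch (map e [0..<Suc (Suc k)]) (h (e 0) (e 1) (\<lambda>i. e (Suc (Suc i))))"
    using h unfolding computable_def by blast
  have step: "rec_eval ch (m # y # map e [0..<k]) (h m y e)" for m y e
    using ch[of "case_nat m (case_nat y e)"] by (simp add: map_env_Suc del: upt_Suc)
  have R: "rec_eval (PrimRec ca ch) (m # map e [0..<k]) (rec_nat (a e) (\<lambda>m y. h m y e) m)" for m e
    by (induction m) (auto intro: rec_eval.primrec_0 rec_eval.primrec_Suc ca step)
  have "computable (Suc k) (\<lambda>e. rec_nat (a (\<lambda>i. e (Suc i))) (\<lambda>m y. h m y (\<lambda>i. e (Suc i))) (e 0))"
    unfolding computable_def map_env_Suc using R by blast
  \<comment> \<open>Substituting \<open>n\<close> for argument \<open>0\<close> and projections for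
    the other arguments undoes the shift of the environment.\<close>
  then have "computable (length (n # map (\<lambda>i e. e i) [0..<k]))
      (\<lambda>e. rec_nat (a (\<lambda>i. e (Suc i))) (\<lambda>m y. h m y (\<lambda>i. e (Suc i))) (e 0))"
    by simp
  moreover have "computable k g" if "g \<in> set (n # map (\<lambda>i e. e i) [0..<k])" for g
    using that n by (auto intro: computable_var)
  ultimately have "computable k (\<lambda>e. rec_nat (a (\<lambda>i. ((n # map (\<lambda>i e. e i) [0..<k]) ! Suc i) e))
      (\<lambda>m y. h m y (\<lambda>i. ((n # map (\<lambda>i e. e i) [0..<k]) ! Suc i) e)) (((n # map (\<lambda>i e. e i) [0..<k]) ! 0) e))"
    by (rule computable_comp)
  then have "computable k (\<lambda>e. rec_nat (a (\<lambda>i. (map (\<lambda>i e. e i) [0..<k] ! i) e))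
      (\<lambda>m y. h m y (\<lambda>i. (map (\<lambda>i e. e i) [0..<k] ! i) e)) (n e))"
    by simp
  then obtain c where c: "\<And>e. rec_eval c (map e [0..<k])
      (rec_nat (a (\<lambda>i. (map (\<lambda>i e. e i) [0..<k] ! i) e))
        (\<lambda>m y. h m y (\<lambda>i. (map (\<lambda>i e. e i) [0..<k] ! i) e)) (n e))"
    by (auto simp: computable_def)
  have eq: "map (\<lambda>i. (map (\<lambda>i e. e i) [0..<k] ! i) e) [0..<k] = map e [0..<k]" for e :: "nat \<Rightarrow> nat"
    by (rule nth_equalityI) auto
  \<comment> \<open>The composed environment is unspecified from \<open>k\<close> on. Both sides are
    values of one code on the same first \<open>k\<close> arguments, so functionality identifies
    them.\<close>
  have "rec_nat (a (\<lambda>i. (map (\<lambda>i e. e i) [0..<k] ! i) e))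
        (\<lambda>m y. h m y (\<lambda>i. (map (\<lambda>i e. e i) [0..<k] ! i) e)) m
      = rec_nat (a e) (\<lambda>m y. h m y e) m" for e m
    using rec_eval_functional[OF R[of m "\<lambda>i. (map (\<lambda>i e. e i) [0..<k] ! i) e", unfolded eq] R] .
  with c show ?thesis unfolding computable_def by auto
qed

lemma computable_pred: "computable k f \<Longrightarrow> computable k (\<lambda>e. f e - 1)"
proof -
  have eq: "n - 1 = rec_nat 0 (\<lambda>m y. m) n" for n by (cases n) auto
  show "computable k (\<lambda>e. f e - 1)" if "computable k f"
    unfolding eq by (intro computable_rec computable_const computable_var that) simp
qed

lemma computable_add:
  assumes "computable k f" "computable k g"
  shows "computable k (\<lambda>e. f e + g e)"
proof -
  have eq: "m + n = rec_nat m (\<lambda>_ y. Suc y) n" for m n by (induction n) auto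
  show ?thesis unfolding eq
    by (intro computable_rec computable_Suc computable_var assms) simp
qed

lemma computable_mult:
  assumes "computable k f" "computable k g"
  shows "computable k (\<lambda>e. f e * g e)"
proof (rule computable_comp2[of "(*)"])
  have eq: "m * n = rec_nat 0 (\<lambda>_ y. m + y) n" for m n :: nat by (induction n) auto
  show "computable 2 (\<lambda>e. e 0 * e 1)" unfolding eq
    by (intro computable_rec computable_add computable_var computable_const; simp)
qed (fact assms)+

lemma computable_minus:
  assumes "computable k f" "computable k g"
  shows "computable k (\<lambda>e. f e - g e)"
proof -
  have eq: "rec_nat m (\<lambda>_ y. y - 1) n = m - n" for m n :: nat by (induction n) auto
  have "computable k (\<lambda>e. rec_nat (f e) (\<lambda>_ y. y - 1) (g e))"
    by (intro computable_rec computable_pred computable_var assms) simp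
  then show ?thesis unfolding eq .
qed

section \<open>Decidable predicates, bounded quantifiers and minimisation\<close>

lemma decidable_cong: "(\<And>e. P e \<longleftrightarrow> Q e) \<Longrightarrow> decidable k Q \<Longrightarrow> decidable k P"
  by (simp add: decidable_def)

lemma decidable_eq: "computable k f \<Longrightarrow> computable k g \<Longrightarrow> decidable k (\<lambda>e. f e = g e)"
proof -
  have "of_bool (a = b) = 1 - ((a - b) + (b - a))" for a b :: nat by auto
  then show "computable k f \<Longrightarrow> computable k g \<Longrightarrow> ?thesis"
    unfolding decidable_def
    by (simp only:) (intro computable_minus computable_add computable_const)
qed

lemma decidable_less: "computable k f \<Longrightarrow> computable k g \<Longrightarrow> decidable k (\<lambda>e. f e < g e)"
proof -
  have "of_bool (a < b) = 1 - (1 - (b - a))" for a b :: nat by auto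
  then show "computable k f \<Longrightarrow> computable k g \<Longrightarrow> ?thesis"
    unfolding decidable_def
    by (simp only:) (intro computable_minus computable_const)
qed

lemma decidable_not:
  assumes "decidable k P"
  shows "decidable k (\<lambda>e. \<not> P e)"
proof -
  have eq: "of_bool (\<not> p) = (1 :: nat) - of_bool p" for p by simp
  show ?thesis
    using assms unfolding decidable_def eq by (intro computable_minus computable_const)
qed

lemma decidable_conj: "decidable k P \<Longrightarrow> decidable k Q \<Longrightarrow> decidable k (\<lambda>e. P e \<and> Q e)"
  unfolding decidable_def of_bool_conj by (rule computable_mult)

lemma decidable_disj: "decidable k P \<Longrightarrow> decidable k Q \<Longrightarrow> decidable k (\<lambda>e. P e \<or> Q e)"
  by (rule decidable_cong[of _ "\<lambda>e. \<not> (\<not> P e \<and> \<not> Q e)"]) (blast, intro decidable_not decidable_conj)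

lemma decidable_imp: "decidable k P \<Longrightarrow> decidable k Q \<Longrightarrow> decidable k (\<lambda>e. P e \<longrightarrow> Q e)"
  by (rule decidable_cong[of _ "\<lambda>e. \<not> (P e \<and> \<not> Q e)"]) (blast, intro decidable_not decidable_conj)

lemma decidable_iff: "decidable k P \<Longrightarrow> decidable k Q \<Longrightarrow> decidable k (\<lambda>e. P e \<longleftrightarrow> Q e)"
  by (rule decidable_cong[of _ "\<lambda>e. (P e \<longrightarrow> Q e) \<and> (Q e \<longrightarrow> P e)"]) (blast, intro decidable_imp decidable_conj)

text \<open>Inserts a dummy argument after the first: inside a primitive recursion the accumulator
  sits there, and a predicate of the counter has to skip it.\<close>

lemma decidable_shift2: "decidable (Suc k) (\<lambda>e. P (e 0) (\<lambda>i. e (Suc i))) \<Longrightarrow>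
  decidable (Suc (Suc k)) (\<lambda>e. P (e 0) (\<lambda>i. e (Suc (Suc i))))"
proof -
  assume P: "decidable (Suc k) (\<lambda>e. P (e 0) (\<lambda>i. e (Suc i)))"
  obtain c where c: "\<And>e. rec_eval c (map e [0..<Suc k]) (of_bool (P (e 0) (\<lambda>i. e (Suc i))))"
    using P unfolding decidable_def computable_def by blast
  have "rec_eval (Comp c (Proj 0 # map (\<lambda>i. Proj (Suc (Suc i))) [0..<k])) (map e [0..<Suc (Suc k)])
      (of_bool (P (e 0) (\<lambda>i. e (Suc (Suc i)))))" for e
  proof (rule rec_eval.comp)
    let ?e = "case_nat (e 0) (\<lambda>i. e (Suc (Suc i)))"
    show "rec_eval c (map ?e [0..<Suc k]) (of_bool (P (e 0) (\<lambda>i. e (Suc (Suc i)))))"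
      using c[of ?e] by simp
    have "rec_eval (Proj i) (map e [0..<Suc (Suc k)]) (e i)" if "i < Suc (Suc k)" for i
      using rec_eval.proj[of i "map e [0..<Suc (Suc k)]"] that by (simp del: upt_Suc)
    then show "list_all2 (\<lambda>g y. rec_eval g (map e [0..<Suc (Suc k)]) y)
        (Proj 0 # map (\<lambda>i. Proj (Suc (Suc i))) [0..<k]) (map ?e [0..<Suc k])"
      unfolding map_env_Suc[of ?e] by (auto simp: list_all2_conv_all_nth nth_Cons split: nat.split simp del: upt_Suc)
  qed
  then show ?thesis unfolding decidable_def computable_def by blast
qed

lemma decidable_bex:
  assumes "decidable (Suc k) (\<lambda>e. P (e 0) (\<lambda>i. e (Suc i)))" "computable k f"
  shows "decidable k (\<lambda>e. \<exists>m<f e. P m e)"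
proof -
  have eq: "of_bool (\<exists>m<n. P m e) = rec_nat 0 (\<lambda>m y. of_bool (\<not> y = 0 \<or> P m e)) n" for n e
  proof (induction n)
    case (Suc n)
    have "(\<exists>m<Suc n. P m e) \<longleftrightarrow> (\<exists>m<n. P m e) \<or> P n e" by (auto simp: less_Suc_eq)
    then show ?case by (simp only: old.nat.rec(2) Suc.IH[symmetric]) simp
  qed simp
  have h: "decidable (Suc (Suc k)) (\<lambda>e. \<not> e 1 = 0 \<or> P (e 0) (\<lambda>i. e (Suc (Suc i))))"
    by (rule decidable_disj[OF decidable_not[OF decidable_eq[OF computable_var computable_const]]
      decidable_shift2[OF assms(1)]]) simp
  show ?thesis
    unfolding decidable_def eq
    using computable_rec[of k "\<lambda>e. 0" "\<lambda>m y e. of_bool (\<not> y = 0 \<or> P m e)" f]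
      computable_const[of k 0] h assms(2) unfolding decidable_def by (simp only:)
qed

lemma decidable_ball:
  assumes "decidable (Suc k) (\<lambda>e. P (e 0) (\<lambda>i. e (Suc i)))" "computable k f"
  shows "decidable k (\<lambda>e. \<forall>m<f e. P m e)"
proof -
  have "decidable k (\<lambda>e. \<exists>m<f e. \<not> P m e)"
    using decidable_not[OF assms(1)] assms(2) by (rule decidable_bex[of k "\<lambda>m e. \<not> P m e" f])
  then have "decidable k (\<lambda>e. \<not> (\<exists>m<f e. \<not> P m e))" by (rule decidable_not)
  then show ?thesis by simp
qed

lemma computable_Least:
  assumes P: "decidable (Suc k) (\<lambda>e. P (e 0) (\<lambda>i. e (Suc i)))" and ex: "\<And>e. \<exists>m. P m e"
  shows "computable k (\<lambda>e. LEAST m. P m e)"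
proof -
  \<comment> \<open>\<open>Mu\<close> searches for the value \<open>0\<close>, hence the
    characteristic function of the negation.\<close>
  obtain c where c: "\<And>e. rec_eval c (map e [0..<Suc k]) (of_bool (\<not> P (e 0) (\<lambda>i. e (Suc i))))"
    using decidable_not[OF P] unfolding decidable_def computable_def by blast
  have c': "rec_eval c (m # map e [0..<k]) (of_bool (\<not> P m e))" for m e
    using c[of "case_nat m e"] by (simp add: map_env_Suc del: upt_Suc)
  have "rec_eval (Mu c) (map e [0..<k]) (LEAST m. P m e)" for e
  proof (rule rec_eval.mu)
    show "rec_eval c ((LEAST m. P m e) # map e [0..<k]) 0"
      using c'[of "LEAST m. P m e" e] LeastI_ex[OF ex[of e]] by simp
    show "\<exists>y. rec_eval c (m # map e [0..<k]) (Suc y)" if "m < (LEAST m. P m e)" for m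
      using c'[of m e] not_less_Least[OF that] by (intro exI[of _ 0]) simp
  qed
  then show ?thesis unfolding computable_def by blast
qed

section \<open>Pairing and coded sequences\<close>

lemma computable_prod_encode:
  assumes "computable k f" "computable k g"
  shows "computable k (\<lambda>e. prod_encode (f e, g e))"
proof -
  have tri: "triangle n = rec_nat 0 (\<lambda>m y. y + Suc m) n" for n by (induction n) auto
  show ?thesis
    unfolding prod_encode_def case_prod_conv tri
    by (intro computable_add computable_rec computable_Suc computable_var computable_const assms) simp_all
qed

lemma computable_snd_prod_decode:
  assumes "computable k f"
  shows "computable k (\<lambda>e. snd (prod_decode (f e)))"
proof (rule computable_comp1[OF _ assms])
  \<comment> \<open>Minimisation finds the second component, while the first is bounded by
    \<open>n\<close> and needs only a bounded quantifier.\<close>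
  have eq: "snd (prod_decode n) = (LEAST b. \<exists>a<Suc n. prod_encode (a, b) = n)" for n
  proof (rule Least_equality[symmetric])
    have "fst (prod_decode n) \<le> n"
      using le_prod_encode_1[of "fst (prod_decode n)" "snd (prod_decode n)"] by simp
    then show "\<exists>a<Suc n. prod_encode (a, snd (prod_decode n)) = n"
      by (intro exI[of _ "fst (prod_decode n)"]) simp
  qed auto
  show "computable 1 (\<lambda>e. snd (prod_decode (e 0)))"
    unfolding eq
  proof (rule computable_Least)
    show "decidable (Suc 1) (\<lambda>e. \<exists>a<Suc (e (Suc 0)). prod_encode (a, e 0) = e (Suc 0))"
      by (intro decidable_bex decidable_eq computable_prod_encode computable_Suc computable_var) simp_all
    show "\<exists>b. \<exists>a<Suc (e 0). prod_encode (a, b) = e 0" for e :: "nat \<Rightarrow> nat"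
      by (metis le_prod_encode_1 less_Suc_eq_le prod_decode_inverse surj_pair)
  qed
qed

lemma computable_fst_prod_decode:
  assumes "computable k f"
  shows "computable k (\<lambda>e. fst (prod_decode (f e)))"
proof (rule computable_comp1[OF _ assms])
  have eq: "fst (prod_decode n) = (LEAST a. prod_encode (a, snd (prod_decode n)) = n)" for n
    by (rule Least_equality[symmetric]) (simp, metis fst_conv order_refl prod_encode_inverse)
  show "computable 1 (\<lambda>e. fst (prod_decode (e 0)))"
    unfolding eq
  proof (rule computable_Least)
    show "decidable (Suc 1) (\<lambda>e. prod_encode (e 0, snd (prod_decode (e (Suc 0)))) = e (Suc 0))"
      by (intro decidable_eq computable_prod_encode computable_snd_prod_decode computable_var) simp_all
    show "\<exists>a. prod_encode (a, snd (prod_decode (e 0))) = e 0" for e :: "nat \<Rightarrow> nat"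
      by (intro exI[of _ "fst (prod_decode (e 0))"]) simp
  qed
qed

text \<open>The number \<open>c\<close> read as an infinite sequence: every finite sequence is an initial segment of some
  \<open>entry c\<close>.\<close>

definition entry :: "nat \<Rightarrow> nat \<Rightarrow> nat" where
  "entry c i = fst (prod_decode (((\<lambda>x. snd (prod_decode x)) ^^ i) c))"

lemma computable_entry:
  assumes "computable k f" "computable k g"
  shows "computable k (\<lambda>e. entry (f e) (g e))"
proof -
  have eq: "((\<lambda>x. snd (prod_decode x)) ^^ i) c = rec_nat c (\<lambda>_ y. snd (prod_decode y)) i" for c i
    by (induction i) auto
  show ?thesis
    unfolding entry_def eq
    by (intro computable_fst_prod_decode computable_rec computable_snd_prod_decode computable_var assms)
      simp_all
qed

lemma entry_exists: "\<exists>c. \<forall>i<n. entry c i = f i"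
proof (induction n arbitrary: f)
  case (Suc n)
  obtain c where c: "\<forall>i<n. entry c i = f (Suc i)" using Suc.IH[of "\<lambda>i. f (Suc i)"] by (elim exE)
  have "entry (prod_encode (f 0, c)) i = f i" if "i < Suc n" for i
    using c that by (cases i) (simp_all add: entry_def funpow_Suc_right del: funpow.simps(2))
  then show ?case by blast
qed auto

text \<open>Post's theorem: some certificate exists for every \<open>n\<close>, and the least one of
  either kind reveals the answer.\<close>

lemma decidable_set_by_search:
  assumes P: "decidable 2 (\<lambda>e. P (e 0) (e 1))" and Q: "decidable 2 (\<lambda>e. Q (e 0) (e 1))"
    and A: "\<And>n. n \<in> A \<longleftrightarrow> (\<exists>c. P c n)" "\<And>n. n \<notin> A \<longleftrightarrow> (\<exists>c. Q c n)"
  shows "decidable_set A"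
proof -
  define L where "L n = (LEAST c. P c n \<or> Q c n)" for n
  have ex: "\<exists>c. P c n \<or> Q c n" for n using A by metis
  have "computable 1 (\<lambda>e. L (e 0))"
    unfolding L_def
    by (rule computable_Least) (use decidable_disj[OF P Q] ex in \<open>simp_all add: numeral_2_eq_2\<close>)
  from computable_comp2[OF P[unfolded decidable_def] this computable_var[of 0 1]]
  have "computable 1 (\<lambda>e. of_bool (P (L (e 0)) (e 0)))" by simp
  then obtain c where c: "\<And>e. rec_eval c (map e [0..<1]) (of_bool (P (L (e 0)) (e 0)))"
    by (auto simp: computable_def)
  have "P (L n) n \<longleftrightarrow> n \<in> A" for n
    using LeastI_ex[OF ex[of n]] A unfolding L_def by blast
  then have "rec_eval c [n] (if n \<in> A then 1 else 0)" for n
    using c[of "\<lambda>_. n"] by (simp add: of_bool_def)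
  then show ?thesis unfolding decidable_set_def by blast
qed

subsection \<open>Proof certificates\<close>

text \<open>The connectives as arithmetic on codes, to which the closure rules for computable
  functions apply.\<close>

definition botc :: nat where "botc = 0"
definition andc :: "nat \<Rightarrow> nat \<Rightarrow> nat" where "andc a b = Suc (6 * prod_encode (a, b) + 1)"
definition orc :: "nat \<Rightarrow> nat \<Rightarrow> nat" where "orc a b = Suc (6 * prod_encode (a, b) + 2)"
definition impc :: "nat \<Rightarrow> nat \<Rightarrow> nat" where "impc a b = Suc (6 * prod_encode (a, b) + 3)"
definition diac :: "nat \<Rightarrow> nat" where "diac a = Suc (6 * a + 4)"
definition boxc :: "nat \<Rightarrow> nat" where "boxc a = Suc (6 * a + 5)"

lemmas code_defs = botc_def andc_def orc_def impc_def diac_def boxc_def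

lemma code_fm:
  "botc = fm_code Bot" "andc (fm_code a) (fm_code b) = fm_code (And a b)"
  "orc (fm_code a) (fm_code b) = fm_code (Or a b)" "impc (fm_code a) (fm_code b) = fm_code (Imp a b)"
  "diac (fm_code a) = fm_code (Dia a)" "boxc (fm_code a) = fm_code (Box a)"
  by (simp_all add: code_defs)

lemma fm_code_eq [simp]: "fm_code a = fm_code b \<longleftrightarrow> a = b"
  using bij_fm_code by (auto simp: bij_def inj_def)

text \<open>By surjectivity of the coding, a certificate never has to check that a number codes a
  formula.\<close>

lemma fm_codeE: obtains a where "n = fm_code a"
  using bij_fm_code by (metis bij_pointE)

definition axc :: "nat \<Rightarrow> nat \<Rightarrow> nat \<Rightarrow> nat \<Rightarrow> bool" where
  "axc a b c n \<longleftrightarrow> n = impc a (impc b a) \<or>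
     n = impc (impc a (impc b c)) (impc (impc a b) (impc a c)) \<or>
     n = impc (andc a b) a \<or> n = impc (andc a b) b \<or> n = impc a (impc b (andc a b)) \<or>
     n = impc a (orc a b) \<or> n = impc b (orc a b) \<or>
     n = impc (impc a c) (impc (impc b c) (impc (orc a b) c)) \<or> n = impc botc a \<or>
     n = impc (boxc (impc a b)) (impc (boxc a) (boxc b)) \<or>
     n = impc (boxc (impc a b)) (impc (diac a) (diac b)) \<or>
     n = impc (boxc a) a \<or> n = impc a (diac a) \<or> n = impc (diac (diac a)) (diac a) \<or>
     n = impc (boxc a) (boxc (boxc a)) \<or>
     n = impc (diac (orc a b)) (orc (diac a) (diac b)) \<or> n = impc (diac botc) botc \<or>
     n = impc (boxc (orc a b)) (orc (boxc a) (diac b))"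

lemma axc_iff: "axc (fm_code a) (fm_code b) (fm_code c) (fm_code x) \<longleftrightarrow> x \<in> axm a b c"
  unfolding axc_def axm_def by (simp only: code_fm fm_code_eq insert_iff empty_iff simp_thms)

lemmas computable_intros = computable_prod_encode computable_entry computable_Suc computable_add
  computable_mult computable_const computable_var

lemmas decidable_intros = decidable_bex decidable_ball decidable_conj decidable_disj decidable_imp
  decidable_iff decidable_not decidable_less decidable_eq

lemma decidable_axc:
  "i < k \<Longrightarrow> j < k \<Longrightarrow> l < k \<Longrightarrow> computable k f \<Longrightarrow> decidable k (\<lambda>e. axc (e i) (e j) (e l) (f e))"
  unfolding axc_def code_defs by (intro decidable_disj decidable_eq computable_intros)

text \<open>Entry \<open>0\<close> of \<open>c\<close> is the length of a derivation, which is listed backwards in the following entries;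
  \<open>c\<close> also bounds the parameters of its axioms.\<close>

definition proves :: "nat \<Rightarrow> nat \<Rightarrow> bool" where
  "proves c n \<longleftrightarrow> 0 < entry c 0 \<and> n = entry c 1 \<and>
     (\<forall>i<entry c 0.
       (\<exists>a<Suc c. \<exists>b<Suc c. \<exists>d<Suc c. axc a b d (entry c (Suc i))) \<or>
       (\<exists>j<entry c 0. \<exists>k<entry c 0. i < j \<and> i < k \<and> entry c (Suc k) = impc (entry c (Suc j)) (entry c (Suc i))) \<or>
       (\<exists>j<entry c 0. i < j \<and> entry c (Suc i) = boxc (entry c (Suc j))))"

lemma decidable_proves: "decidable 2 (\<lambda>e. proves (e 0) (e 1))"
  unfolding proves_def code_defs
  by (intro decidable_axc decidable_intros computable_intros; simp)

lemma proves_sound: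
  assumes "proves c n"
  shows "n \<in> fm_code ` Ded"
proof -
  let ?L = "entry c 0"
  have "i < ?L \<Longrightarrow> entry c (Suc i) \<in> fm_code ` Ded" for i
  \<comment> \<open>Premises have larger indices than conclusions, so the distance to the end of the
    list decreases.\<close>
  proof (induction "?L - i" arbitrary: i rule: less_induct)
    case less
    obtain x where x: "entry c (Suc i) = fm_code x" by (rule fm_codeE)
    have IH: "entry c (Suc j) \<in> fm_code ` Ded" if "i < j" "j < ?L" for j
      using less.hyps[of j] that by simp
    from assms less.prems consider
      a b d where "axc a b d (entry c (Suc i))"
      | j k where "j < ?L" "k < ?L" "i < j" "i < k" "entry c (Suc k) = impc (entry c (Suc j)) (entry c (Suc i))"
      | j where "j < ?L" "i < j" "entry c (Suc i) = boxc (entry c (Suc j))"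
      unfolding proves_def by blast
    then have "x \<in> Ded"
    proof cases
      case 1
      obtain a' b' d' where "a = fm_code a'" "b = fm_code b'" "d = fm_code d'" by (meson fm_codeE)
      with 1 x have "x \<in> axm a' b' d'" using axc_iff by simp
      then show ?thesis by (rule Ded.ax)
    next
      case 2
      obtain y z where yz: "y \<in> Ded" "z \<in> Ded" "entry c (Suc j) = fm_code y" "entry c (Suc k) = fm_code z"
        using IH[of j] IH[of k] 2 by blast
      with 2 x have "z = Imp y x" by (simp add: code_fm del: fm_code.simps)
      with yz show ?thesis using Ded.mp by blast
    next
      case 3
      obtain y where "y \<in> Ded" "entry c (Suc j) = fm_code y" using IH[of j] 3 by blast
      with 3 x have "x = Box y" by (simp add: code_fm del: fm_code.simps)
      with \<open>y \<in> Ded\<close> show ?thesis using Ded.nec by blast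
    qed
    with x show ?case by simp
  qed
  from this[of 0] assms show ?thesis by (simp add: proves_def)
qed

text \<open>\<open>M\<close> bounds the parameters of the axioms, because \<open>proves\<close>
  searches for them only below a bound. Premises lie in the tail, so derivations can be
  concatenated.\<close>

inductive derivation :: "nat \<Rightarrow> fm list \<Rightarrow> bool" for M where
  Nil: "derivation M []"
| ax: "\<lbrakk>derivation M xs; x \<in> axm a b c; fm_code a \<le> M; fm_code b \<le> M; fm_code c \<le> M\<rbrakk> \<Longrightarrow> derivation M (x # xs)"
| mp: "\<lbrakk>derivation M xs; Imp a b \<in> set xs; a \<in> set xs\<rbrakk> \<Longrightarrow> derivation M (b # xs)"
| nec: "\<lbrakk>derivation M xs; a \<in> set xs\<rbrakk> \<Longrightarrow> derivation M (Box a # xs)"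

lemma derivation_mono: "derivation M xs \<Longrightarrow> M \<le> N \<Longrightarrow> derivation N xs"
  by (induction rule: derivation.induct) (auto intro: derivation.intros order_trans)

lemma derivation_append: "derivation M xs \<Longrightarrow> derivation M ys \<Longrightarrow> derivation M (xs @ ys)"
  by (induction rule: derivation.induct) (auto intro: derivation.intros)

lemma derivation_exists: "x \<in> Ded \<Longrightarrow> \<exists>M xs. derivation M (x # xs)"
proof (induction rule: Ded.induct)
  case (ax x a b c)
  then have "derivation (fm_code a + fm_code b + fm_code c) [x]"
    by (intro derivation.ax[OF derivation.Nil]) auto
  then show ?case by blast
next
  case (mp a b)
  then obtain M xs N ys where "derivation M (Imp a b # xs)" "derivation N (a # ys)" by blast
  then have "derivation (max M N) ((Imp a b # xs) @ (a # ys))"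
    by (intro derivation_append) (auto elim: derivation_mono)
  then have "derivation (max M N) (b # (Imp a b # xs) @ (a # ys))"
    by (rule derivation.mp) auto
  then show ?case by blast
next
  case (nec a)
  then obtain M xs where "derivation M (a # xs)" by blast
  then have "derivation M (Box a # a # xs)" by (rule derivation.nec) simp
  then show ?case by blast
qed

text \<open>A derivation step in terms of positions, mirroring the three alternatives in
  \<open>proves\<close>.\<close>

definition justified :: "nat \<Rightarrow> fm list \<Rightarrow> nat \<Rightarrow> bool" where
  "justified M xs i \<longleftrightarrow>
    (\<exists>a b c. xs ! i \<in> axm a b c \<and> fm_code a \<le> M \<and> fm_code b \<le> M \<and> fm_code c \<le> M) \<or>
    (\<exists>j<length xs. \<exists>k<length xs. i < j \<and> i < k \<and> xs ! k = Imp (xs ! j) (xs ! i)) \<or>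
    (\<exists>j<length xs. i < j \<and> xs ! i = Box (xs ! j))"

lemma justified_Cons:
  assumes "justified M xs i"
  shows "justified M (x # xs) (Suc i)"
proof -
  from assms consider
    a b c where "xs ! i \<in> axm a b c" "fm_code a \<le> M" "fm_code b \<le> M" "fm_code c \<le> M"
    | j k where "j < length xs" "k < length xs" "i < j" "i < k" "xs ! k = Imp (xs ! j) (xs ! i)"
    | j where "j < length xs" "i < j" "xs ! i = Box (xs ! j)"
    unfolding justified_def by blast
  then show ?thesis
  proof cases
    case 1
    then show ?thesis unfolding justified_def by (intro disjI1 exI) auto
  next
    case 2
    then show ?thesis unfolding justified_def
      by (intro disjI2 disjI1 exI[of _ "Suc j"] exI[of _ "Suc k"] conjI) simp_all
  next
    case 3
    then show ?thesis unfolding justified_def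
      by (intro disjI2 exI[of _ "Suc j"] conjI) simp_all
  qed
qed

lemma derivation_justified:
  "derivation M xs \<Longrightarrow> i < length xs \<Longrightarrow> justified M xs i"
proof (induction arbitrary: i rule: derivation.induct)
  case (ax xs x a b c)
  then show ?case
  proof (cases i)
    case 0
    then show ?thesis using ax.hyps unfolding justified_def by (intro disjI1) auto
  qed (simp add: justified_Cons)
next
  case (mp xs a b)
  then show ?case
  proof (cases i)
    case 0
    obtain j k where "j < length xs" "k < length xs" "xs ! k = Imp a b" "xs ! j = a"
      using mp.hyps by (auto simp: in_set_conv_nth)
    then show ?thesis unfolding 0 justified_def
      by (intro disjI2 disjI1 exI[of _ "Suc j"] exI[of _ "Suc k"] conjI) simp_all
  qed (simp add: justified_Cons)
next
  case (nec xs a)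
  then show ?case
  proof (cases i)
    case 0
    obtain j where "j < length xs" "xs ! j = a" using nec.hyps by (auto simp: in_set_conv_nth)
    then show ?thesis unfolding 0 justified_def
      by (intro disjI2 exI[of _ "Suc j"] conjI) simp_all
  qed (simp add: justified_Cons)
qed simp

lemma entry_le: "entry c i \<le> c"
proof -
  have "((\<lambda>x. snd (prod_decode x)) ^^ i) c \<le> c"
  proof (induction i)
    case (Suc i)
    have "snd (prod_decode x) \<le> x" for x
      using le_prod_encode_2[of "snd (prod_decode x)" "fst (prod_decode x)"] by simp
    then show ?case using Suc by (auto intro: order_trans)
  qed simp
  moreover have "fst (prod_decode x) \<le> x" for x
    using le_prod_encode_1[of "fst (prod_decode x)" "snd (prod_decode x)"] by simp
  ultimately show ?thesis unfolding entry_def by (meson order_trans)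
qed

lemma proves_complete:
  assumes "x \<in> Ded"
  shows "\<exists>c. proves c (fm_code x)"
proof -
  obtain M ys where "derivation M (x # ys)" using derivation_exists[OF assms] by blast
  define xs where "xs = x # ys"
  then have xs: "derivation M xs" "0 < length xs" "xs ! 0 = x" using \<open>derivation M (x # ys)\<close> by simp_all
  let ?L = "length xs"
  \<comment> \<open>The entry after the last formula stores \<open>M\<close>, so that
    \<open>entry_le\<close> yields \<open>M \<le> c\<close>.\<close>
  define f where "f i = (if i = 0 then ?L else if i \<le> ?L then fm_code (xs ! (i - 1)) else M)" for i
  obtain c where c: "\<forall>i<Suc (Suc ?L). entry c i = f i" using entry_exists[of "Suc (Suc ?L)" f] by (elim exE)
  have L: "entry c 0 = ?L" using c by (simp add: f_def)
  have e: "entry c (Suc i) = fm_code (xs ! i)" if "i < ?L" for i using c that by (simp add: f_def)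
  have M: "M \<le> c" using entry_le[of c "Suc ?L"] c by (simp add: f_def)
  have "proves c (fm_code x)"
    unfolding proves_def L
  proof (intro conjI allI impI)
    show "fm_code x = entry c 1" using e[of 0] xs by simp
    fix i assume i: "i < ?L"
    from derivation_justified[OF xs(1) i] consider
      a b d where "xs ! i \<in> axm a b d" "fm_code a \<le> M" "fm_code b \<le> M" "fm_code d \<le> M"
      | j k where "j < ?L" "k < ?L" "i < j" "i < k" "xs ! k = Imp (xs ! j) (xs ! i)"
      | j where "j < ?L" "i < j" "xs ! i = Box (xs ! j)"
      unfolding justified_def by blast
    then show "(\<exists>a<Suc c. \<exists>b<Suc c. \<exists>d<Suc c. axc a b d (entry c (Suc i))) \<or>
       (\<exists>j<?L. \<exists>k<?L. i < j \<and> i < k \<and> entry c (Suc k) = impc (entry c (Suc j)) (entry c (Suc i))) \<or>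
       (\<exists>j<?L. i < j \<and> entry c (Suc i) = boxc (entry c (Suc j)))"
    proof cases
      case 1
      then have "axc (fm_code a) (fm_code b) (fm_code d) (entry c (Suc i))" using e[OF i] axc_iff by simp
      moreover have "fm_code a < Suc c" "fm_code b < Suc c" "fm_code d < Suc c" using 1 M by auto
      ultimately show ?thesis by blast
    next
      case 2
      then have "entry c (Suc k) = impc (entry c (Suc j)) (entry c (Suc i))" using e i by (simp add: code_fm del: fm_code.simps)
      with 2 show ?thesis by blast
    next
      case 3
      then have "entry c (Suc i) = boxc (entry c (Suc j))" using e i by (simp add: code_fm del: fm_code.simps)
      with 3 show ?thesis by blast
    qed
  qed (use xs in simp)
  then show ?thesis by blast
qed

subsection \<open>Countermodel certificates\<close>

text \<open>All tables share one sequence: table, row and column are paired into a position, shifted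
  by one because entry \<open>0\<close> is taken. Every value other than \<open>1\<close> reads as
  false, so no number is a malformed table.\<close>

definition cell :: "nat \<Rightarrow> nat \<Rightarrow> nat \<Rightarrow> nat \<Rightarrow> bool" where
  "cell c t i j \<longleftrightarrow> entry c (Suc (prod_encode (t, prod_encode (i, j)))) = 1"

text \<open>The worlds are the numbers below entry \<open>0\<close>; tables \<open>0\<close> and \<open>1\<close> hold the two preorders and table
  \<open>2\<close> the truth values of all formulas with code up to \<open>n\<close>.\<close>

definition refutes :: "nat \<Rightarrow> nat \<Rightarrow> bool" where
  "refutes c n \<longleftrightarrow>
    (\<forall>i<entry c 0. cell c 0 i i \<and> cell c 1 i i) \<and>
    (\<forall>i<entry c 0. \<forall>j<entry c 0. \<forall>k<entry c 0. cell c 0 i j \<longrightarrow> cell c 0 j k \<longrightarrow> cell c 0 i k) \<and>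
    (\<forall>i<entry c 0. \<forall>j<entry c 0. \<forall>k<entry c 0. cell c 1 i j \<longrightarrow> cell c 1 j k \<longrightarrow> cell c 1 i k) \<and>
    (\<forall>i<entry c 0. \<forall>j<entry c 0. \<forall>k<entry c 0. cell c 0 i j \<longrightarrow> cell c 1 i k \<longrightarrow>
      (\<exists>l<entry c 0. cell c 0 k l \<and> cell c 1 j l)) \<and>
    (\<forall>i<entry c 0. \<forall>j<entry c 0. \<forall>k<entry c 0. cell c 0 i j \<longrightarrow> cell c 1 j k \<longrightarrow>
      (\<exists>l<entry c 0. cell c 1 i l \<and> cell c 0 l k)) \<and>
    (\<forall>i<entry c 0. \<forall>j<entry c 0. \<forall>a<Suc n. cell c 0 i j \<longrightarrow> cell c 2 i a \<longrightarrow> cell c 2 j a) \<and>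
    (\<forall>i<entry c 0. \<not> cell c 2 i botc) \<and>
    (\<forall>i<entry c 0. \<forall>a<Suc n. \<forall>b<Suc n. andc a b < Suc n \<longrightarrow>
      (cell c 2 i (andc a b) \<longleftrightarrow> cell c 2 i a \<and> cell c 2 i b)) \<and>
    (\<forall>i<entry c 0. \<forall>a<Suc n. \<forall>b<Suc n. orc a b < Suc n \<longrightarrow>
      (cell c 2 i (orc a b) \<longleftrightarrow> cell c 2 i a \<or> cell c 2 i b)) \<and>
    (\<forall>i<entry c 0. \<forall>a<Suc n. \<forall>b<Suc n. impc a b < Suc n \<longrightarrow>
      (cell c 2 i (impc a b) \<longleftrightarrow> (\<forall>j<entry c 0. cell c 0 i j \<longrightarrow> cell c 2 j a \<longrightarrow> cell c 2 j b))) \<and>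
    (\<forall>i<entry c 0. \<forall>a<Suc n. diac a < Suc n \<longrightarrow>
      (cell c 2 i (diac a) \<longleftrightarrow> (\<exists>j<entry c 0. cell c 1 i j \<and> cell c 2 j a))) \<and>
    (\<forall>i<entry c 0. \<forall>a<Suc n. boxc a < Suc n \<longrightarrow>
      (cell c 2 i (boxc a) \<longleftrightarrow> (\<forall>j<entry c 0. cell c 1 i j \<longrightarrow> cell c 2 j a))) \<and>
    (\<exists>i<entry c 0. \<not> cell c 2 i n)"

lemma decidable_refutes: "decidable 2 (\<lambda>e. refutes (e 0) (e 1))"
  unfolding refutes_def cell_def code_defs
  by (intro decidable_intros computable_intros; simp)

lemma code_le:
  "fm_code a \<le> fm_code (And a b)" "fm_code b \<le> fm_code (And a b)"
  "fm_code a \<le> fm_code (Or a b)" "fm_code b \<le> fm_code (Or a b)"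
  "fm_code a \<le> fm_code (Imp a b)" "fm_code b \<le> fm_code (Imp a b)"
  "fm_code a \<le> fm_code (Dia a)" "fm_code a \<le> fm_code (Box a)"
  using le_prod_encode_1[of "fm_code a" "fm_code b"] le_prod_encode_2[of "fm_code b" "fm_code a"]
  by simp_all

lemma refutes_sound:
  assumes "refutes c (fm_code x)"
  shows "x \<notin> Ded"
proof -
  define n where "n = fm_code x"
  define N where "N = entry c 0"
  note cert = assms[unfolded refutes_def, folded n_def N_def]
  note crefl = cert[THEN conjunct1]
    and cile = cert[THEN conjunct2, THEN conjunct1]
    and cmle = cert[THEN conjunct2, THEN conjunct2, THEN conjunct1]
    and cup = cert[THEN conjunct2, THEN conjunct2, THEN conjunct2, THEN conjunct1]
    and cdown = cert[THEN conjunct2, THEN conjunct2, THEN conjunct2, THEN conjunct2, THEN conjunct1]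
    and cmono = cert[THEN conjunct2, THEN conjunct2, THEN conjunct2, THEN conjunct2, THEN conjunct2, THEN conjunct1]
    and cbot = cert[THEN conjunct2, THEN conjunct2, THEN conjunct2, THEN conjunct2, THEN conjunct2, THEN conjunct2, THEN conjunct1]
    and cand = cert[THEN conjunct2, THEN conjunct2, THEN conjunct2, THEN conjunct2, THEN conjunct2, THEN conjunct2, THEN conjunct2, THEN conjunct1]
    and cor = cert[THEN conjunct2, THEN conjunct2, THEN conjunct2, THEN conjunct2, THEN conjunct2, THEN conjunct2, THEN conjunct2, THEN conjunct2, THEN conjunct1]
    and cimp = cert[THEN conjunct2, THEN conjunct2, THEN conjunct2, THEN conjunct2, THEN conjunct2, THEN conjunct2, THEN conjunct2, THEN conjunct2, THEN conjunct2, THEN conjunct1]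
    and cdia = cert[THEN conjunct2, THEN conjunct2, THEN conjunct2, THEN conjunct2, THEN conjunct2, THEN conjunct2, THEN conjunct2, THEN conjunct2, THEN conjunct2, THEN conjunct2, THEN conjunct1]
    and cbox = cert[THEN conjunct2, THEN conjunct2, THEN conjunct2, THEN conjunct2, THEN conjunct2, THEN conjunct2, THEN conjunct2, THEN conjunct2, THEN conjunct2, THEN conjunct2, THEN conjunct2, THEN conjunct1]
    and cfail = cert[THEN conjunct2, THEN conjunct2, THEN conjunct2, THEN conjunct2, THEN conjunct2, THEN conjunct2, THEN conjunct2, THEN conjunct2, THEN conjunct2, THEN conjunct2, THEN conjunct2, THEN conjunct2]
  define F :: "nat frame" where "F = \<lparr>worlds = {..<N}, fallible = {},
    ile = {(i, j). i < N \<and> j < N \<and> cell c 0 i j}, mle = {(i, j). i < N \<and> j < N \<and> cell c 1 i j}\<rparr>"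
  \<comment> \<open>Persistence is certified only for codes up to \<open>n\<close>, so variables
    with larger codes are made false everywhere.\<close>
  define V where "V v = {i. i < N \<and> fm_code (Var v) \<le> n \<and> cell c 2 i (fm_code (Var v))}" for v
  have F [simp]: "worlds F = {..<N}" "fallible F = {}"
    "(i, j) \<in> ile F \<longleftrightarrow> i < N \<and> j < N \<and> cell c 0 i j"
    "(i, j) \<in> mle F \<longleftrightarrow> i < N \<and> j < N \<and> cell c 1 i j" for i j
    by (simp_all add: F_def)
  have "preorder_on (worlds F) (ile F)"
    unfolding preorder_on_def refl_on_def trans_on_def
  proof (intro conjI ballI impI)
    show "ile F \<subseteq> worlds F \<times> worlds F" by auto
    show "(i, i) \<in> ile F" if "i \<in> worlds F" for i using that crefl by simp
    show "(i, k) \<in> ile F" if "(i, j) \<in> ile F" "(j, k) \<in> ile F" for i j k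
      using that cile unfolding F by blast
  qed
  moreover have "preorder_on (worlds F) (mle F)"
    unfolding preorder_on_def refl_on_def trans_on_def
  proof (intro conjI ballI impI)
    show "mle F \<subseteq> worlds F \<times> worlds F" by auto
    show "(i, i) \<in> mle F" if "i \<in> worlds F" for i using that crefl by simp
    show "(i, k) \<in> mle F" if "(i, j) \<in> mle F" "(j, k) \<in> mle F" for i j k
      using that cmle unfolding F by blast
  qed
  moreover have "forth_up F"
    using cup unfolding forth_up_def F by blast
  moreover have "forth_down F"
    using cdown unfolding forth_down_def F by blast
  ultimately have frame: "S4I_frame F"
    by (simp add: S4I_frame_def bi_frame_def infallible_def up_closed_def)
  have "j \<in> V v" if "i \<in> V v" "(i, j) \<in> ile F" for i j v
    using that cmono unfolding V_def F mem_Collect_eq less_Suc_eq_le by blast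
  then have "valuation F V" by (auto simp: valuation_def up_closed_def V_def)
  with frame have model: "S4I_model F V" by (rule S4I_model.intro)
  \<comment> \<open>The modal clauses of the certificate mention only the modal relation; confluence
    of the frame just built reconciles them with \<open>sat\<close>.\<close>
  note dia = S4I_model.sat_Dia_iff[OF model] and box = S4I_model.sat_Box_iff[OF model]
  have truth: "fm_code y \<le> n \<Longrightarrow> i < N \<Longrightarrow> sat F V i y \<longleftrightarrow> cell c 2 i (fm_code y)" for y i
  proof (induction y arbitrary: i)
    case (Var v)
    then show ?case by (simp add: V_def)
  next
    case Bot
    then show ?case using cbot by (simp add: botc_def)
  next
    case (And a b)
    have le: "fm_code a \<le> n" "fm_code b \<le> n" using code_le(1,2)[where a=a and b=b] And.prems by linarith+
    have "cell c 2 i (andc (fm_code a) (fm_code b)) \<longleftrightarrow> cell c 2 i (fm_code a) \<and> cell c 2 i (fm_code b)"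
      using cand[rule_format, of i "fm_code a" "fm_code b"] le And.prems unfolding code_fm less_Suc_eq_le by blast
    then show ?case using And.IH le And.prems unfolding code_fm by simp
  next
    case (Or a b)
    have le: "fm_code a \<le> n" "fm_code b \<le> n" using code_le(3,4)[where a=a and b=b] Or.prems by linarith+
    have "cell c 2 i (orc (fm_code a) (fm_code b)) \<longleftrightarrow> cell c 2 i (fm_code a) \<or> cell c 2 i (fm_code b)"
      using cor[rule_format, of i "fm_code a" "fm_code b"] le Or.prems unfolding code_fm less_Suc_eq_le by blast
    then show ?case using Or.IH le Or.prems unfolding code_fm by simp
  next
    case (Imp a b)
    have le: "fm_code a \<le> n" "fm_code b \<le> n" using code_le(5,6)[where a=a and b=b] Imp.prems by linarith+
    have "cell c 2 i (impc (fm_code a) (fm_code b)) \<longleftrightarrow>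
        (\<forall>j<N. cell c 0 i j \<longrightarrow> cell c 2 j (fm_code a) \<longrightarrow> cell c 2 j (fm_code b))"
      using cimp[rule_format, of i "fm_code a" "fm_code b"] le Imp.prems unfolding code_fm less_Suc_eq_le by blast
    then show ?case using Imp.IH le Imp.prems unfolding code_fm by auto
  next
    case (Dia a)
    have le: "fm_code a \<le> n" using code_le(7)[of a] Dia.prems by linarith
    have "cell c 2 i (diac (fm_code a)) \<longleftrightarrow> (\<exists>j<N. cell c 1 i j \<and> cell c 2 j (fm_code a))"
      using cdia[rule_format, of i "fm_code a"] le Dia.prems unfolding code_fm less_Suc_eq_le by blast
    then show ?case using Dia.IH[OF le] Dia.prems dia[of i a] unfolding code_fm
      by (auto simp del: sat.simps fm_code.simps)
  next
    case (Box a)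
    have le: "fm_code a \<le> n" using code_le(8)[of a] Box.prems by linarith
    have "cell c 2 i (boxc (fm_code a)) \<longleftrightarrow> (\<forall>j<N. cell c 1 i j \<longrightarrow> cell c 2 j (fm_code a))"
      using cbox[rule_format, of i "fm_code a"] le Box.prems unfolding code_fm less_Suc_eq_le by blast
    then show ?case using Box.IH[OF le] Box.prems box[of i a] unfolding code_fm
      by (auto simp del: sat.simps fm_code.simps)
  qed
  obtain i where i: "i < N" "\<not> cell c 2 i n" using cfail by blast
  then have "\<not> sat F V i x" using truth[of x i] by (simp add: n_def)
  then show ?thesis using S4I_model.sound[OF model, of x i] i(1) by auto
qed

lemma refutes_complete:
  assumes "x \<notin> Ded"
  shows "\<exists>c. refutes c (fm_code x)"
proof -
  obtain G :: "nat frame" and N U i0 where G: "S4I_frame G" "worlds G = {..<N}" "valuation G U"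
    and i0: "i0 < N" "\<not> sat G U i0 x" by (rule finite_completeness[OF assms])
  interpret S4I_model G U using G(1,3) by (rule S4I_model.intro)
  define n where "n = fm_code x"
  define f where "f k = (case k of 0 \<Rightarrow> N | Suc m \<Rightarrow>
    (case prod_decode m of (t, p) \<Rightarrow> case prod_decode p of (i, j) \<Rightarrow>
      of_bool (if t = 0 then (i, j) \<in> ile G else if t = 1 then (i, j) \<in> mle G
        else sat G U i (inv fm_code j))))" for k
  \<comment> \<open>Columns up to \<open>N + n\<close> cover both the worlds in the relation tables
    and the codes in the truth table.\<close>
  let ?I = "(\<lambda>(t, i, j). Suc (prod_encode (t, prod_encode (i, j)))) ` ({..2} \<times> {..<N} \<times> {..N + n})"
  have "finite ?I" by simp
  then obtain L where "\<forall>k\<in>?I. k < L" unfolding finite_nat_set_iff_bounded by (elim exE)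
  then have L: "t \<le> 2 \<Longrightarrow> i < N \<Longrightarrow> j \<le> N + n \<Longrightarrow>
      Suc (prod_encode (t, prod_encode (i, j))) < L" for t i j
    by simp
  obtain c where c: "\<forall>i<Suc L. entry c i = f i" using entry_exists[of "Suc L" f] by (elim exE)
  have N: "entry c 0 = N" using c by (simp add: f_def)
  have cell: "cell c t i j \<longleftrightarrow> (if t = 0 then (i, j) \<in> ile G else if t = 1 then (i, j) \<in> mle G
        else sat G U i (inv fm_code j))" if "t \<le> 2" "i < N" "j \<le> N + n" for t i j
    using c L[OF that] by (simp add: cell_def f_def del: One_nat_def)
  have ile: "cell c 0 i j \<longleftrightarrow> (i, j) \<in> ile G" if "i < N" "j < N" for i j
    using cell[of 0 i j] that by simp
  have mle: "cell c 1 i j \<longleftrightarrow> (i, j) \<in> mle G" if "i < N" "j < N" for i j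
    using cell[of 1 i j] that by simp
  have sat: "cell c 2 i (fm_code y) \<longleftrightarrow> sat G U i y" if "i < N" "fm_code y < Suc n" for i y
    using cell[of 2 i "fm_code y"] that bij_fm_code by (simp add: bij_is_inj)
  \<comment> \<open>Since every number is a code, the numerical quantifiers of
    \<open>refutes\<close> become quantifiers over formulas.\<close>
  have all: "(\<forall>a<Suc n. P a) \<longleftrightarrow> (\<forall>y. fm_code y < Suc n \<longrightarrow> P (fm_code y))" for P
    by (metis fm_codeE)
  have w: "i < N \<and> j < N" if "(i, j) \<in> ile G \<or> (i, j) \<in> mle G" for i j
    using that ile_worlds mle_worlds G(2) by blast
  have "refutes c (fm_code x)"
    unfolding refutes_def N n_def[symmetric] all
  proof (intro conjI allI impI)
    show "cell c 0 i i" "cell c 1 i i" if "i < N" for i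
      using that ile mle ile_refl mle_refl G(2) by simp_all
    show "cell c 0 i k" if "i < N" "j < N" "k < N" "cell c 0 i j" "cell c 0 j k" for i j k
      using that ile ile_trans by blast
    show "cell c 1 i k" if "i < N" "j < N" "k < N" "cell c 1 i j" "cell c 1 j k" for i j k
      using that mle mle_trans by blast
    show "\<exists>l<N. cell c 0 k l \<and> cell c 1 j l"
      if ijk: "i < N" "j < N" "k < N" "cell c 0 i j" "cell c 1 i k" for i j k
    proof -
      have "(i, j) \<in> ile G" "(i, k) \<in> mle G" using ijk ile mle by blast+
      then obtain l where "(k, l) \<in> ile G" "(j, l) \<in> mle G" by (rule forth_upE)
      with w ile mle show ?thesis by blast
    qed
    show "\<exists>l<N. cell c 1 i l \<and> cell c 0 l k"
      if ijk: "i < N" "j < N" "k < N" "cell c 0 i j" "cell c 1 j k" for i j k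
    proof -
      have "(i, j) \<in> ile G" "(j, k) \<in> mle G" using ijk ile mle by blast+
      then obtain l where "(i, l) \<in> mle G" "(l, k) \<in> ile G" by (rule forth_downE)
      with w ile mle show ?thesis by blast
    qed
    show "cell c 2 j (fm_code y)"
      if "i < N" "j < N" "fm_code y < Suc n" "cell c 0 i j" "cell c 2 i (fm_code y)" for i j y
      using that ile sat sat_mono by blast
    show "\<not> cell c 2 i botc" if "i < N" for i
      using that sat[of i Bot] by (simp add: botc_def)
    show "cell c 2 i (andc (fm_code a) (fm_code b)) \<longleftrightarrow> cell c 2 i (fm_code a) \<and> cell c 2 i (fm_code b)"
      if "i < N" "fm_code a < Suc n" "fm_code b < Suc n" "andc (fm_code a) (fm_code b) < Suc n" for i a b
      using that unfolding code_fm by (simp add: sat del: fm_code.simps)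
    show "cell c 2 i (orc (fm_code a) (fm_code b)) \<longleftrightarrow> cell c 2 i (fm_code a) \<or> cell c 2 i (fm_code b)"
      if "i < N" "fm_code a < Suc n" "fm_code b < Suc n" "orc (fm_code a) (fm_code b) < Suc n" for i a b
      using that unfolding code_fm by (simp add: sat del: fm_code.simps)
    show "cell c 2 i (impc (fm_code a) (fm_code b)) \<longleftrightarrow>
        (\<forall>j<N. cell c 0 i j \<longrightarrow> cell c 2 j (fm_code a) \<longrightarrow> cell c 2 j (fm_code b))"
      if "i < N" "fm_code a < Suc n" "fm_code b < Suc n" "impc (fm_code a) (fm_code b) < Suc n" for i a b
    proof -
      have "(\<forall>j<N. cell c 0 i j \<longrightarrow> cell c 2 j (fm_code a) \<longrightarrow> cell c 2 j (fm_code b)) \<longleftrightarrow>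
          (\<forall>j. (i, j) \<in> ile G \<longrightarrow> sat G U j a \<longrightarrow> sat G U j b)"
        using that w ile sat by metis
      with that show ?thesis unfolding code_fm by (simp add: sat del: fm_code.simps)
    qed
    show "cell c 2 i (diac (fm_code a)) \<longleftrightarrow> (\<exists>j<N. cell c 1 i j \<and> cell c 2 j (fm_code a))"
      if "i < N" "fm_code a < Suc n" "diac (fm_code a) < Suc n" for i a
    proof -
      have "(\<exists>j<N. cell c 1 i j \<and> cell c 2 j (fm_code a)) \<longleftrightarrow> (\<exists>j. (i, j) \<in> mle G \<and> sat G U j a)"
        using that w mle sat by metis
      also have "\<dots> \<longleftrightarrow> sat G U i (Dia a)" using sat_Dia_iff[of i a] that(1) G(2) by blast
      finally show ?thesis using that unfolding code_fm by (simp add: sat del: fm_code.simps sat.simps)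
    qed
    show "cell c 2 i (boxc (fm_code a)) \<longleftrightarrow> (\<forall>j<N. cell c 1 i j \<longrightarrow> cell c 2 j (fm_code a))"
      if "i < N" "fm_code a < Suc n" "boxc (fm_code a) < Suc n" for i a
    proof -
      have "(\<forall>j<N. cell c 1 i j \<longrightarrow> cell c 2 j (fm_code a)) \<longleftrightarrow> (\<forall>j. (i, j) \<in> mle G \<longrightarrow> sat G U j a)"
        using that w mle sat by metis
      also have "\<dots> \<longleftrightarrow> sat G U i (Box a)" using sat_Box_iff[of i a] that(1) G(2) by blast
      finally show ?thesis using that unfolding code_fm by (simp add: sat del: fm_code.simps sat.simps)
    qed
    show "\<exists>i<N. \<not> cell c 2 i n" using i0 sat[of i0 x] n_def by auto
  qed
  then show ?thesis by blast
qed

lemma decidable_S4I: "decidable_logic S4I"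
  unfolding decidable_logic_def S4I_eq_Ded
proof (rule decidable_set_by_search[OF decidable_proves decidable_refutes])
  fix n
  obtain x where x: "n = fm_code x" by (rule fm_codeE)
  have mem: "n \<in> fm_code ` Ded \<longleftrightarrow> x \<in> Ded" unfolding x by auto
  show "n \<in> fm_code ` Ded \<longleftrightarrow> (\<exists>c. proves c n)"
    unfolding mem unfolding x using proves_sound[of _ "fm_code x"] proves_complete[of x] mem x by auto
  show "n \<notin> fm_code ` Ded \<longleftrightarrow> (\<exists>c. refutes c n)"
    unfolding mem unfolding x using refutes_sound[of _ x] refutes_complete[of x] by auto
qed

theorem mainTheorem4:
  shows "(\<forall>\<phi>. (\<exists>F :: 'w frame. S4I_frame F \<and> falsifiable_on F \<phi>) \<longrightarrow>
           (\<exists>G :: nat frame. S4I_frame G \<and> finite (worlds G) \<and> falsifiable_on G \<phi>)) \<and>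
         (\<forall>\<phi>. (\<exists>F :: 'w frame. S4I_frame F \<and> satisfiable_on F \<phi>) \<longrightarrow>
           (\<exists>G :: nat frame. S4I_frame G \<and> finite (worlds G) \<and> satisfiable_on G \<phi>)) \<and>
         decidable_logic S4I"
proof (intro conjI allI impI)
  fix \<phi>
  assume "\<exists>F :: 'w frame. S4I_frame F \<and> falsifiable_on F \<phi>"
  then obtain F :: "'w frame" and V w where
    F: "S4I_frame F" "valuation F V" "w \<in> worlds F" "\<not> sat F V w \<phi>"
    unfolding falsifiable_on_def by blast
  obtain G :: "nat frame" and n U i where G: "S4I_frame G" "worlds G = {..<n}" "valuation G U"
    "i \<in> worlds G" "sat G U i \<phi> \<longleftrightarrow> sat F V w \<phi>"
    by (rule finite_model[OF F(1-3)])
  then have "i \<in> worlds G - fallible G" by (simp add: S4I_frame_def infallible_def)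
  with F(4) G show "\<exists>G :: nat frame. S4I_frame G \<and> finite (worlds G) \<and> falsifiable_on G \<phi>"
    unfolding falsifiable_on_def by (metis finite_lessThan)
next
  fix \<phi>
  assume "\<exists>F :: 'w frame. S4I_frame F \<and> satisfiable_on F \<phi>"
  then obtain F :: "'w frame" and V w where
    F: "S4I_frame F" "valuation F V" "w \<in> worlds F" "sat F V w \<phi>"
    unfolding satisfiable_on_def by blast
  obtain G :: "nat frame" and n U i where G: "S4I_frame G" "worlds G = {..<n}" "valuation G U"
    "i \<in> worlds G" "sat G U i \<phi> \<longleftrightarrow> sat F V w \<phi>"
    by (rule finite_model[OF F(1-3)])
  then have "i \<in> worlds G - fallible G" by (simp add: S4I_frame_def infallible_def)
  with F(4) G show "\<exists>G :: nat frame. S4I_frame G \<and> finite (worlds G) \<and> satisfiable_on G \<phi>"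
    unfolding satisfiable_on_def by (metis finite_lessThan)
qed (rule decidable_S4I)

end
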